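(* Let $(\Omega,\mathcal{F},P)$ be a probability space, $(B,\|\cdot\|)$ a Banach space over $\mathbb{K}$ ($\mathbb{K}=\mathbb{R}$ or $\mathbb{C}$), $V$ a nonempty weakly compact convex subset of $B$ with normal structure, and $T$ a strong random isometric operator from $\Omega\times V$ to $V$. Then there is a strong random element $x^0:\Omega\to c(V,V)$ such that $T(\omega,x^0(\omega))=x^0(\omega)$ for almost all $\omega\in\Omega$.
   Context: Chebyshev center: for a nonempty bounded $K\subset B$ and nonempty $F\subset B$, $r(K,x)=\sup\{\|x-y\|:y\in K\}$ for $x\in B$, $r(K,F)=\inf\{r(K,x):x\in F\}$, and $c(K,F)=\{x\in F:r(K,x)=r(K,F)\}$; $c(V,V)$ is the Chebyshev center of $V$. Normal structure: a nonempty bounded closed convex set $K\subset B$ has normal structure if every closed convex subset $F$ of $K$ containing more than one point has a point $x\in F$ with $r(F,x)<\sup\{\|z-y\|:y,z\in F\}$. For a metric space $M$, a map $X:\Omega\to M$ is a random element if $X^{-1}(U)\in\mathcal{F}$ for each open $U\subset M$; it is simple if it takes only finitely many values; it is a strong random element if it is the pointwise limit of a sequence of simple random elements (equivalently, it is a random element with separable range). For metric spaces $(M,d)$, $(M_1,d_1)$, a map $T:\Omega\times M\to M_1$ is a strong random operator if $T(\cdot,x)$ is a strong random element for each $x\in M$; it is random isometric if for each $\omega\in\Omega$, $d_1(T(\omega,x),T(\omega,y))=d(x,y)$ for all $x,y\in M$. A strong random isometric operator is one that is both. Here $V$ carries the norm metric. *)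

theory Defs
  imports "HOL-Probability.Probability"
begin

text \<open>
  Scalar fields that are isometrically isomorphic to the reals or to the complex numbers. In the
  second alternative \<open>j\<close> plays the role of the imaginary unit.
\<close>

class real_or_complex = real_normed_field +
  assumes real_or_complex:
    "(\<forall>z. \<exists>a. z = a *\<^sub>R 1) \<or>
     (\<exists>j. j * j = - 1 \<and> (\<forall>z. \<exists>a b. z = a *\<^sub>R 1 + b *\<^sub>R j) \<and>
          (\<forall>a b. norm (a *\<^sub>R 1 + b *\<^sub>R j) = sqrt (a\<^sup>2 + b\<^sup>2)))"

instance real :: real_or_complex
  by standard simp

instance complex :: real_or_complex
proof
  have "\<exists>a b. z = a *\<^sub>R 1 + b *\<^sub>R \<i>" for z
    by (intro exI[of _ "Re z"] exI[of _ "Im z"]) (simp add: complex_eq_iff)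
  moreover have "norm (a *\<^sub>R 1 + b *\<^sub>R \<i>) = sqrt (a\<^sup>2 + b\<^sup>2)" for a b
    by (simp add: norm_complex_def)
  ultimately show "(\<forall>z::complex. \<exists>a. z = a *\<^sub>R 1) \<or>
     (\<exists>j::complex. j * j = - 1 \<and> (\<forall>z. \<exists>a b. z = a *\<^sub>R 1 + b *\<^sub>R j) \<and>
          (\<forall>a b. norm (a *\<^sub>R 1 + b *\<^sub>R j) = sqrt (a\<^sup>2 + b\<^sup>2)))"
    by (intro disjI2 exI[of _ "\<i>"]) simp
qed

text \<open>
  The class \<open>banach\<close> only knows real scalars. A Banach space over the field \<open>'k\<close> is given by an
  additional scalar multiplication, whose restriction to the reals is \<open>scaleR\<close>.
\<close>

locale banach_space_over = vector_space smul
  for smul :: "'k::real_or_complex \<Rightarrow> 'b::banach \<Rightarrow> 'b" +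
  assumes norm_smul: "norm (smul a x) = norm a * norm x"
    and smul_of_real: "smul (of_real r) x = r *\<^sub>R x"

lemma banach_space_over_scaleR:
  "banach_space_over (scaleR :: real \<Rightarrow> 'b::banach \<Rightarrow> 'b)"
  by standard (simp_all add: scaleR_add_right scaleR_add_left)

lemma banach_space_over_complex:
  "banach_space_over ((*) :: complex \<Rightarrow> complex \<Rightarrow> complex)"
  by standard (simp_all add: algebra_simps norm_mult scaleR_conv_of_real)

definition weak_topology :: "('k::real_or_complex \<Rightarrow> 'b::banach \<Rightarrow> 'b) \<Rightarrow> 'b topology" where
  "weak_topology smul = topology_generated_by
     {f -` U | f U. Vector_Spaces.linear smul (*) f \<and> continuous_on UNIV f \<and> open (U :: 'k set)}"

text \<open>
  The suprema and infima below are taken in the reals, so these notions are meaningful only for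
  nonempty bounded \<open>K\<close> and nonempty \<open>F\<close>.
\<close>

definition cheb_radius_at :: "'b::real_normed_vector set \<Rightarrow> 'b \<Rightarrow> real" where
  "cheb_radius_at K x = (SUP y\<in>K. norm (x - y))"

definition cheb_radius :: "'b::real_normed_vector set \<Rightarrow> 'b set \<Rightarrow> real" where
  "cheb_radius K F = (INF x\<in>F. cheb_radius_at K x)"

definition cheb_center :: "'b::real_normed_vector set \<Rightarrow> 'b set \<Rightarrow> 'b set" where
  "cheb_center K F = {x \<in> F. cheb_radius_at K x = cheb_radius K F}"

text \<open>
  Normal structure is a notion for nonempty bounded closed convex \<open>K\<close>; these properties of \<open>K\<close>
  are not part of the predicate. Weakly compact convex sets are bounded and closed.
\<close>

definition normal_structure :: "'b::real_normed_vector set \<Rightarrow> bool" where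
  "normal_structure K \<longleftrightarrow>
     (\<forall>F\<subseteq>K. closed F \<and> convex F \<and> (\<exists>a\<in>F. \<exists>b\<in>F. a \<noteq> b) \<longrightarrow>
        (\<exists>x\<in>F. cheb_radius_at F x < (SUP (z, y)\<in>F \<times> F. norm (z - y))))"

text \<open>
  The metric space in which a random element takes its values is a subset \<open>S\<close> of a metric type,
  with the restricted metric. In particular, the simple random elements approximating a strong
  random element take their values in \<open>S\<close>.
\<close>

definition random_element :: "'w measure \<Rightarrow> 'a::metric_space set \<Rightarrow> ('w \<Rightarrow> 'a) \<Rightarrow> bool" where
  "random_element M S X \<longleftrightarrow>
     X \<in> space M \<rightarrow> S \<and> (\<forall>U. openin (top_of_set S) U \<longrightarrow> X -` U \<inter> space M \<in> sets M)"

definition simple_random_element :: "'w measure \<Rightarrow> 'a::metric_space set \<Rightarrow> ('w \<Rightarrow> 'a) \<Rightarrow> bool" where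
  "simple_random_element M S X \<longleftrightarrow> random_element M S X \<and> finite (X ` space M)"

definition strong_random_element :: "'w measure \<Rightarrow> 'a::metric_space set \<Rightarrow> ('w \<Rightarrow> 'a) \<Rightarrow> bool" where
  "strong_random_element M S X \<longleftrightarrow>
     X \<in> space M \<rightarrow> S \<and>
     (\<exists>Y :: nat \<Rightarrow> 'w \<Rightarrow> 'a. (\<forall>n. simple_random_element M S (Y n)) \<and>
        (\<forall>\<omega>\<in>space M. (\<lambda>n. Y n \<omega>) \<longlonglongrightarrow> X \<omega>))"

definition strong_random_operator ::
  "'w measure \<Rightarrow> 'a::metric_space set \<Rightarrow> 'c::metric_space set \<Rightarrow> ('w \<Rightarrow> 'a \<Rightarrow> 'c) \<Rightarrow> bool" where
  "strong_random_operator M S S' T \<longleftrightarrow> (\<forall>x\<in>S. strong_random_element M S' (\<lambda>\<omega>. T \<omega> x))"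

definition random_isometric ::
  "'w measure \<Rightarrow> 'a::metric_space set \<Rightarrow> ('w \<Rightarrow> 'a \<Rightarrow> 'c::metric_space) \<Rightarrow> bool" where
  "random_isometric M S T \<longleftrightarrow>
     (\<forall>\<omega>\<in>space M. \<forall>x\<in>S. \<forall>y\<in>S. dist (T \<omega> x) (T \<omega> y) = dist x y)"

definition strong_random_isometric_operator ::
  "'w measure \<Rightarrow> 'a::metric_space set \<Rightarrow> 'c::metric_space set \<Rightarrow> ('w \<Rightarrow> 'a \<Rightarrow> 'c) \<Rightarrow> bool" where
  "strong_random_isometric_operator M S S' T \<longleftrightarrow>
     strong_random_operator M S S' T \<and> random_isometric M S T"

end

theory Submission imports Defs begin

text \<open>
  Every single \<open>T \<omega>\<close> has a fixed point in the Chebyshev center \<open>C\<close> of \<open>V\<close>, but such a point must be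
  chosen in a measurable way, although \<open>V\<close> may be nonseparable and neither
  convexity nor weak closedness of the fixed point sets is available.

  For a fixed \<open>\<omega>\<close>, weak compactness enters only as the finite intersection property for closed
  convex sets (\<open>weakly_compact_imp_convexly_compact\<close>), which rests on Hahn-Banach separation.
  Together with normal structure it yields Kirk's theorem: a nonexpansive self-map of a
  nonempty closed convex subset of \<open>V\<close> has a fixed point. Applied to the set of points from which the images
  \<open>(T \<omega>)\<^sup>n V\<close> are eventually seen within the Chebyshev radius, up to any \<open>\<epsilon> > 0\<close>, it gives a fixed
  point that lies in \<open>C\<close> (\<open>isometry_fixed_point_in_cheb_center\<close>).

  The reduction to the separable case uses that each \<open>T \<sqdot> x\<close> has a separable range. Starting from a
  point of \<open>C\<close>, countably many steps build a separable closed convex set \<open>W \<subseteq> V\<close> that all \<open>T \<omega>\<close>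
  map into itself (\<open>countable_rationally_convex_extension\<close>). The fixed point theorem, relative to
  \<open>W\<close>, then shows that every \<open>T \<omega>\<close> has a fixed point in the separable closed set \<open>K = W \<inter> C\<close>.

  Finally, a measurable choice of fixed points in \<open>K\<close> exists outside a null set
  (\<open>random_fixed_point\<close>). The events that \<open>T \<omega>\<close> has a fixed point in a given small ball need not be
  measurable. They are replaced by measurable envelopes inside the measurable events that the center
  of the ball is almost fixed, and a successive choice of ever smaller balls leads to a point that
  is exactly fixed (\<open>measurable_selection\<close>).
\<close>

section \<open>Separation of convex sets by linear functionals\<close>

definition sublinear :: "('b::real_vector \<Rightarrow> real) \<Rightarrow> bool" where
  "sublinear q \<longleftrightarrow>
     (\<forall>x y. q (x + y) \<le> q x + q y) \<and> (\<forall>t x. 0 \<le> t \<longrightarrow> q (t *\<^sub>R x) \<le> t * q x)"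

lemma sublinear_add: "sublinear q \<Longrightarrow> q (x + y) \<le> q x + q y"
  by (simp add: sublinear_def)

lemma sublinear_scaleR: "sublinear q \<Longrightarrow> 0 \<le> t \<Longrightarrow> q (t *\<^sub>R x) \<le> t * q x"
  by (simp add: sublinear_def)

lemma sublinear_minus: "sublinear q \<Longrightarrow> - q (- x) \<le> q x"
  using sublinear_add[of q x "- x"] sublinear_scaleR[of q 2 0] by simp

text \<open>
  The Hahn-Banach argument takes infima of families of functions three times: over a chain of
  sublinear functions, over the translates of one such function, and over a cone. In all three
  cases the family as a whole is subadditive and homogeneous in this sense, although its members
  need not be sublinear.
\<close>

lemma sublinear_INF:
  fixes h :: "'i \<Rightarrow> 'b::real_vector \<Rightarrow> real"
  assumes "I \<noteq> {}" and bdd: "\<And>x. bdd_below ((\<lambda>i. h i x) ` I)"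
    and add: "\<And>i j. i \<in> I \<Longrightarrow> j \<in> I \<Longrightarrow> \<exists>k\<in>I. \<forall>x y. h k (x + y) \<le> h i x + h j y"
    and scale: "\<And>i t. i \<in> I \<Longrightarrow> 0 \<le> t \<Longrightarrow> \<exists>k\<in>I. \<forall>x. h k (t *\<^sub>R x) \<le> t * h i x"
  shows "sublinear (\<lambda>x. INF i\<in>I. h i x)"
proof -
  let ?u = "\<lambda>x. INF i\<in>I. h i x"
  have le: "?u x \<le> h i x" if "i \<in> I" for i x
    using that by (intro cINF_lower bdd)
  have *: "?u (x + y) \<le> h i x + h j y" if "i \<in> I" "j \<in> I" for i j x y
    using add[OF that] le order_trans by metis
  have "?u (x + y) - h i x \<le> ?u y" if "i \<in> I" for i x y
  proof (rule cINF_greatest[OF \<open>I \<noteq> {}\<close>])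
    fix j assume "j \<in> I"
    then show "?u (x + y) - h i x \<le> h j y" using *[OF that, of j x y] by simp
  qed
  note ** = this
  have add': "?u (x + y) - ?u y \<le> ?u x" for x y
  proof (rule cINF_greatest[OF \<open>I \<noteq> {}\<close>])
    fix i assume "i \<in> I"
    then show "?u (x + y) - ?u y \<le> h i x" using **[of i x y] by simp
  qed
  have "?u (x + y) \<le> ?u x + ?u y" for x y
    using add'[of x y] by simp
  moreover have "?u (t *\<^sub>R x) \<le> t * ?u x" if "0 \<le> t" for t x
  proof -
    have *: "?u (t *\<^sub>R x) \<le> t * h i x" if "i \<in> I" for i
      using scale[OF that \<open>0 \<le> t\<close>] le order_trans by metis
    show ?thesis
    proof (cases "t = 0")
      case True
      with * \<open>I \<noteq> {}\<close> show ?thesis by auto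
    next
      case False
      with * \<open>0 \<le> t\<close> have "?u (t *\<^sub>R x) / t \<le> ?u x"
        by (intro cINF_greatest \<open>I \<noteq> {}\<close>) (simp add: divide_le_eq mult.commute)
      with False \<open>0 \<le> t\<close> show ?thesis by (simp add: divide_le_eq mult.commute)
    qed
  qed
  ultimately show ?thesis
    unfolding sublinear_def by blast
qed

text \<open>
  For fixed \<open>y\<close>, the function \<open>x \<mapsto> inf\<^sub>s (q (x + s y) - s q(y))\<close> is sublinear and lies below \<open>q\<close>, so by
  minimality it equals \<open>q\<close>. Its term with \<open>s = 1\<close> gives \<open>q x \<le> q (x + y) - q y\<close>, which is the missing
  half of additivity.
\<close>

lemma linear_if_minimal_sublinear:
  fixes q :: "'b::real_vector \<Rightarrow> real"
  assumes q: "sublinear q"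
    and minimal: "\<And>q'. sublinear q' \<Longrightarrow> (\<And>x. q' x \<le> q x) \<Longrightarrow> q' = q"
  shows "linear q"
proof -
  have add: "q (x + y) = q x + q y" for x y
  proof -
    define h where "h s x = q (x + s *\<^sub>R y) - s * q y" for s x
    have lower: "- q (- x) \<le> h s x" if "0 \<le> s" for s x
    proof -
      have "q (s *\<^sub>R y) = s * q y"
      proof (cases "s = 0")
        case True
        then show ?thesis
          using sublinear_scaleR[OF q, of 0 y] sublinear_add[OF q, of 0 0] by simp
      next
        case False
        have "q (inverse s *\<^sub>R s *\<^sub>R y) \<le> inverse s * q (s *\<^sub>R y)"
          using that by (intro sublinear_scaleR q) simp
        with False that sublinear_scaleR[OF q, of s y] show ?thesis
          by (simp add: field_simps)
      qed
      then show ?thesis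
        using sublinear_add[OF q, of "- x" "x + s *\<^sub>R y"] by (simp add: h_def)
    qed
    have bdd: "bdd_below ((\<lambda>s. h s x) ` {0..})" for x
      by (rule bdd_belowI[where m = "- q (- x)"]) (use lower in auto)
    have "sublinear (\<lambda>x. INF s\<in>{0..}. h s x)"
    proof (rule sublinear_INF[OF _ bdd])
      fix i j :: real assume "i \<in> {0..}" "j \<in> {0..}"
      moreover have "h (i + j) (x + z) \<le> h i x + h j z" for x z
        using sublinear_add[OF q, of "x + i *\<^sub>R y" "z + j *\<^sub>R y"] by (simp add: h_def algebra_simps)
      ultimately show "\<exists>k\<in>{0..}. \<forall>x z. h k (x + z) \<le> h i x + h j z"
        by (intro bexI[of _ "i + j"]) auto
    next
      fix i t :: real assume "i \<in> {0..}" "0 \<le> t"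
      moreover have "h (t * i) (t *\<^sub>R x) \<le> t * h i x" for x
        using sublinear_scaleR[OF q \<open>0 \<le> t\<close>, of "x + i *\<^sub>R y"] by (simp add: h_def algebra_simps)
      ultimately show "\<exists>k\<in>{0..}. \<forall>x. h k (t *\<^sub>R x) \<le> t * h i x"
        by (intro bexI[of _ "t * i"]) auto
    qed auto
    moreover have "(INF s\<in>{0..}. h s x) \<le> q x" for x
      using cINF_lower[OF bdd, of 0 x] by (simp add: h_def)
    ultimately have "(\<lambda>x. INF s\<in>{0..}. h s x) = q"
      by (rule minimal)
    then have "q x = (INF s\<in>{0..}. h s x)" by metis
    also have "\<dots> \<le> h 1 x" by (rule cINF_lower[OF bdd]) simp
    finally show ?thesis
      using sublinear_add[OF q, of x y] by (simp add: h_def)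
  qed
  have neg: "q (- x) = - q x" for x
    using add[of x "- x"] add[of 0 0] by simp
  have pos: "q (t *\<^sub>R x) = t * q x" if "0 \<le> t" for t x
    using sublinear_scaleR[OF q that, of x] sublinear_scaleR[OF q that, of "- x"]
    by (simp add: neg)
  have "q (t *\<^sub>R x) = t * q x" for t x
    using pos[of t x] pos[of "- t" x] neg[of "t *\<^sub>R x"] by (cases "0 \<le> t") auto
  with add show ?thesis by (intro linearI) auto
qed

text \<open>
  Zorn's lemma provides a minimal sublinear function below \<open>p\<close>. The pointwise infimum of a chain is
  finite, because a sublinear \<open>q \<le> p\<close> satisfies \<open>- p (- x) \<le> q x\<close>.
\<close>

lemma Hahn_Banach_sublinear:
  fixes p :: "'b::real_vector \<Rightarrow> real"
  assumes p: "sublinear p"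
  obtains f where "linear f" "\<And>x. f x \<le> p x"
proof -
  define A where "A = {q. sublinear q \<and> q \<le> p}"
  let ?P = "\<lambda>q q' :: 'b \<Rightarrow> real. q' \<le> q"
  have "\<exists>m\<in>A. \<forall>a\<in>A. ?P m a \<longrightarrow> a = m"
  proof (rule predicate_Zorn)
    show "partial_order_on A (relation_of ?P A)"
      by (rule partial_order_on_relation_ofI) auto
    fix C assume C: "C \<in> Chains (relation_of ?P A)"
    then have sub: "C \<subseteq> A" and chain: "\<And>q q'. q \<in> C \<Longrightarrow> q' \<in> C \<Longrightarrow> q \<le> q' \<or> q' \<le> q"
      by (auto simp: Chains_def relation_of_def)
    show "\<exists>u\<in>A. \<forall>a\<in>C. ?P a u"
    proof (cases "C = {}")
      case True
      then show ?thesis using p by (auto simp: A_def)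
    next
      case False
      have bdd: "bdd_below ((\<lambda>q. q x) ` C)" for x
      proof (rule bdd_belowI2)
        fix q assume "q \<in> C"
        then have "sublinear q" "q (- x) \<le> p (- x)" using sub by (auto simp: A_def le_fun_def)
        then show "- p (- x) \<le> q x" using sublinear_minus[of q x] by simp
      qed
      let ?u = "\<lambda>x. INF q\<in>C. q x"
      have lower: "?u x \<le> q x" if "q \<in> C" for q x
        using that by (intro cINF_lower bdd)
      have "sublinear ?u"
      proof (rule sublinear_INF[OF False bdd])
        fix q q' assume "q \<in> C" "q' \<in> C"
        then obtain k where k: "k \<in> C" "k \<le> q" "k \<le> q'" "sublinear k"
          using chain[of q q'] sub by (auto simp: A_def)
        then have "k (x + y) \<le> q x + q' y" for x y
          using sublinear_add[of k x y] by (smt (verit) le_fun_def)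
        with k show "\<exists>k\<in>C. \<forall>x y. k (x + y) \<le> q x + q' y" by blast
      next
        fix q and t :: real assume "q \<in> C" "0 \<le> t"
        then show "\<exists>k\<in>C. \<forall>x. k (t *\<^sub>R x) \<le> t * q x"
          using sub by (intro bexI[of _ q]) (auto simp: A_def sublinear_scaleR)
      qed
      moreover obtain q where "q \<in> C" "q \<le> p" using False sub by (auto simp: A_def)
      then have "?u \<le> p"
        by (auto simp: le_fun_def intro!: order_trans[OF lower])
      ultimately show ?thesis
        using lower by (intro bexI[of _ ?u]) (auto simp: A_def le_fun_def)
    qed
  qed
  then obtain q where q: "sublinear q" "q \<le> p"
    and min: "\<And>q'. sublinear q' \<Longrightarrow> q' \<le> p \<Longrightarrow> q' \<le> q \<Longrightarrow> q' = q"
    by (auto simp: A_def)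
  have "linear q"
  proof (rule linear_if_minimal_sublinear[OF q(1)])
    fix q' assume q': "sublinear q'" "\<And>x. q' x \<le> q x"
    then have "q' \<le> q" by (simp add: le_funI)
    with q' q(2) show "q' = q" by (intro min) auto
  qed
  with q show thesis by (intro that[of q]) (auto simp: le_fun_def)
qed

text \<open>
  Separation of \<open>x\<close> from \<open>A\<close> with a gap equal to their distance. The infimum of
  \<open>\<parallel>z + t (a - x)\<parallel> - t \<delta>\<close> over \<open>t \<ge> 0\<close> and \<open>a \<in> A\<close>, with \<open>\<delta>\<close> the distance, is finite because
  \<open>\<parallel>t (a - x)\<parallel> \<ge> t \<delta>\<close>, and sublinear because the pairs \<open>(t, a)\<close> parametrise the convex cone over \<open>A - x\<close>.
  A linear functional below it is dominated by the norm (take \<open>t = 0\<close>) and is at most \<open>- \<delta>\<close> at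
  \<open>x - a\<close> (take \<open>t = 1\<close>). For \<open>A = {0}\<close> this produces norming functionals.
\<close>

lemma convex_separation:
  fixes A :: "'b::real_normed_vector set"
  assumes "convex A"
  obtains f :: "'b \<Rightarrow> real"
  where "linear f" "\<And>z. \<bar>f z\<bar> \<le> norm z" "\<And>a. a \<in> A \<Longrightarrow> f x + infdist x A \<le> f a"
proof (cases "A = {}")
  case True
  show thesis
    by (rule that[of "\<lambda>_. 0"]) (auto simp: True intro: linearI)
next
  case False
  define \<delta> where "\<delta> = infdist x A"
  have dist: "\<delta> \<le> norm (a - x)" if "a \<in> A" for a
    using infdist_le[OF that, of x] by (simp add: \<delta>_def dist_norm norm_minus_commute)
  define h where "h = (\<lambda>(t, a) z. norm (z + t *\<^sub>R (a - x)) - t * \<delta>)"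
  let ?I = "{0::real..} \<times> A"
  have bdd: "bdd_below ((\<lambda>i. h i z) ` ?I)" for z
  proof (rule bdd_belowI2)
    fix i assume "i \<in> ?I"
    then obtain t a where i: "i = (t, a)" "0 \<le> t" "a \<in> A" by auto
    have "t * \<delta> \<le> norm (t *\<^sub>R (a - x))"
      using i dist[of a] by (simp add: mult_left_mono)
    also have "\<dots> \<le> norm (z + t *\<^sub>R (a - x)) + norm z"
      using norm_triangle_ineq4[of "z + t *\<^sub>R (a - x)" z] by simp
    finally show "- norm z \<le> h i z" by (simp add: h_def i)
  qed
  have "sublinear (\<lambda>z. INF i\<in>?I. h i z)"
  proof (rule sublinear_INF[OF _ bdd])
    show "?I \<noteq> {}" using False by auto
  next
    fix i j assume "i \<in> ?I" "j \<in> ?I"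
    then obtain t a s b where ij: "i = (t, a)" "j = (s, b)" "0 \<le> t" "0 \<le> s" "a \<in> A" "b \<in> A"
      by auto
    obtain c where c: "c \<in> A" "(t + s) *\<^sub>R c = t *\<^sub>R a + s *\<^sub>R b"
    proof (cases "t + s = 0")
      case True
      with ij have "t = 0" "s = 0" by auto
      with ij that[of a] show thesis by simp
    next
      case False
      let ?c = "(t / (t + s)) *\<^sub>R a + (s / (t + s)) *\<^sub>R b"
      have "?c \<in> A"
        using ij False
        by (intro convexD[OF \<open>convex A\<close>]) (auto simp flip: add_divide_distrib)
      moreover have "(t + s) *\<^sub>R ?c = t *\<^sub>R a + s *\<^sub>R b"
        using False by (simp add: scaleR_add_right)
      ultimately show thesis by (rule that)
    qed
    have "h (t + s, c) (y + z) \<le> h i y + h j z" for y z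
    proof -
      have "y + z + (t + s) *\<^sub>R (c - x) = (y + t *\<^sub>R (a - x)) + (z + s *\<^sub>R (b - x))"
        using c(2) by (simp add: algebra_simps)
      then show ?thesis
        using norm_triangle_ineq[of "y + t *\<^sub>R (a - x)" "z + s *\<^sub>R (b - x)"]
        by (simp add: h_def ij algebra_simps)
    qed
    with c(1) ij show "\<exists>k\<in>?I. \<forall>y z. h k (y + z) \<le> h i y + h j z"
      by (intro bexI[of _ "(t + s, c)"]) auto
  next
    fix i and t :: real assume "i \<in> ?I" "0 \<le> t"
    then obtain s a where i: "i = (s, a)" "0 \<le> s" "a \<in> A" by auto
    have "h (t * s, a) (t *\<^sub>R z) \<le> t * h i z" for z
    proof -
      have "t *\<^sub>R z + (t * s) *\<^sub>R (a - x) = t *\<^sub>R (z + s *\<^sub>R (a - x))"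
        by (simp add: algebra_simps)
      then have "norm (t *\<^sub>R z + (t * s) *\<^sub>R (a - x)) = t * norm (z + s *\<^sub>R (a - x))"
        using \<open>0 \<le> t\<close> by simp
      then show ?thesis by (simp add: h_def i right_diff_distrib)
    qed
    with i \<open>0 \<le> t\<close> show "\<exists>k\<in>?I. \<forall>z. h k (t *\<^sub>R z) \<le> t * h i z"
      by (intro bexI[of _ "(t * s, a)"]) auto
  qed
  then obtain f where f: "linear f" and le: "\<And>z. f z \<le> (INF i\<in>?I. h i z)"
    using Hahn_Banach_sublinear by blast
  have le_h: "f z \<le> norm (z + t *\<^sub>R (a - x)) - t * \<delta>" if "0 \<le> t" "a \<in> A" for z t a
    using le[of z] cINF_lower[OF bdd, of "(t, a)" z] that by (auto simp: h_def)
  have norm: "f z \<le> norm z" for z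
    using False le_h[of 0 _ z] by auto
  have "\<bar>f z\<bar> \<le> norm z" for z
    using norm[of z] norm[of "- z"] linear_neg[OF f, of z] by simp
  moreover have "f x + \<delta> \<le> f a" if "a \<in> A" for a
    using le_h[of 1 a "x - a"] that linear_diff[OF f, of x a] by simp
  ultimately show thesis using f by (intro that) (simp_all add: \<delta>_def)
qed

section \<open>Closed convex subsets of a weakly compact set\<close>

text \<open>
  The only consequence of weak compactness that enters the fixed point argument. It does not
  mention the scalar field, the weak topology or functionals, and passes to closed convex subsets.
\<close>

definition convexly_compact :: "'b::real_normed_vector set \<Rightarrow> bool" where
  "convexly_compact V \<longleftrightarrow>
     (\<forall>\<U>. (\<forall>C\<in>\<U>. closed C \<and> convex C) \<and> (\<forall>\<F>. finite \<F> \<and> \<F> \<subseteq> \<U> \<longrightarrow> V \<inter> \<Inter>\<F> \<noteq> {}) \<longrightarrow>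
          V \<inter> \<Inter>\<U> \<noteq> {})"

lemma real_or_complex_real_part:
  obtains (real) "\<And>z::'k::real_or_complex. \<exists>a. z = of_real a"
  | (complex) j :: "'k::real_or_complex" and \<rho> :: "'k::real_or_complex \<Rightarrow> real"
  where "j * j = - 1" "\<And>z. \<exists>b. z = of_real (\<rho> z) + of_real b * j"
    "\<And>a b. \<rho> (of_real a + of_real b * j) = a" "continuous_on UNIV \<rho>"
proof -
  consider "\<forall>z::'k. \<exists>a. z = a *\<^sub>R 1"
    | j :: 'k where "j * j = - 1" "\<forall>z. \<exists>a b. z = a *\<^sub>R 1 + b *\<^sub>R j"
      "\<forall>a b. norm (a *\<^sub>R 1 + b *\<^sub>R j) = sqrt (a\<^sup>2 + b\<^sup>2)"
    using real_or_complex[where 'a = 'k] by blast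
  then show thesis
  proof cases
    case 1
    then show thesis by (intro real) (simp add: of_real_def)
  next
    case (2 j)
    have abs_le: "\<bar>a\<bar> \<le> norm (of_real a + of_real b * j)" for a b
      using 2(3) by (simp add: of_real_def)
    have "\<forall>z. \<exists>a b. z = of_real a + of_real b * j"
      using 2(2) by (simp add: of_real_def)
    then obtain \<rho> \<sigma> where z: "\<And>z. z = of_real (\<rho> z) + of_real (\<sigma> z) * j"
      by metis
    have dist: "\<bar>\<rho> z - \<rho> w\<bar> \<le> norm (z - w)" for z w
    proof -
      have "z - w = of_real (\<rho> z - \<rho> w) + of_real (\<sigma> z - \<sigma> w) * j"
        by (subst (1) z[of z], subst (1) z[of w]) (simp add: algebra_simps)
      then show ?thesis using abs_le by metis
    qed
    have "\<rho> (of_real a + of_real b * j) = a" for a b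
    proof -
      let ?z = "of_real a + of_real b * j"
      have "of_real (\<rho> ?z - a) + of_real (\<sigma> ?z - b) * j = 0"
        using z[of ?z] by (simp add: algebra_simps)
      with abs_le[of "\<rho> ?z - a" "\<sigma> ?z - b"] show ?thesis by simp
    qed
    moreover have "continuous_on UNIV \<rho>"
      unfolding continuous_on_iff
      using dist by (metis dist_norm real_norm_def dist_commute order_le_less_trans)
    ultimately show thesis using 2(1) z by (intro complex) blast+
  qed
qed

context banach_space_over
begin

text \<open>
  Over the complex numbers a real functional \<open>f\<close> is the real part of \<open>x \<mapsto> f x - i f (i x)\<close>. Hence real
  separation suffices for the weak topology defined by \<open>'k\<close>-linear functionals.
\<close>

lemma real_part_of_functional:
  fixes f :: "'b \<Rightarrow> real"
  assumes f: "linear f" and cont: "continuous_on UNIV f"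
  obtains g :: "'b \<Rightarrow> 'k" and \<rho> :: "'k \<Rightarrow> real"
  where "Vector_Spaces.linear smul (*) g" "continuous_on UNIV g"
    "continuous_on UNIV \<rho>" "\<And>x. \<rho> (g x) = f x"
proof -
  have vs: "vector_space ((*) :: 'k \<Rightarrow> 'k \<Rightarrow> 'k)"
    by standard (simp_all add: algebra_simps)
  have linearI: "Vector_Spaces.linear smul (*) g"
    if "\<And>x y. g (x + y) = g x + g y" "\<And>c x. g (smul c x) = c * g x" for g :: "'b \<Rightarrow> 'k"
    using that vs vector_space_axioms
    by (auto simp: Vector_Spaces.linear_iff vector_space_def)
  show thesis
  proof (cases rule: real_or_complex_real_part[where 'k = 'k])
    case real
    have "g (smul c x) = c * g x" if "g = (\<lambda>x. of_real (f x) :: 'k)" for g c x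
    proof -
      obtain a where "c = of_real a" using real by blast
      then show ?thesis using that f by (simp add: smul_of_real linear_scale)
    qed
    then have "Vector_Spaces.linear smul (*) (\<lambda>x. of_real (f x) :: 'k)"
      using f by (intro linearI) (auto simp: linear_add)
    moreover define \<rho> :: "'k \<Rightarrow> real" where "\<rho> z = (THE a. z = of_real a)" for z
    have \<rho>: "\<rho> (of_real a) = a" for a by (simp add: \<rho>_def)
    have "continuous_on UNIV \<rho>"
      unfolding continuous_on_iff
    proof clarify
      fix z :: 'k and e :: real assume "0 < e"
      have "dist (\<rho> w) (\<rho> z) = dist w z" for w
      proof -
        obtain a b where "z = of_real a" "w = of_real b" using real by metis
        then show ?thesis by (simp add: \<rho> dist_norm flip: of_real_diff)
      qed
      with \<open>0 < e\<close> show "\<exists>d>0. \<forall>w\<in>UNIV. dist w z < d \<longrightarrow> dist (\<rho> w) (\<rho> z) < e" by auto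
    qed
    ultimately show thesis
      using cont \<rho> by (intro that) (auto intro!: continuous_intros)
  next
    case (complex j \<rho>)
    \<comment> \<open>\<open>j\<close> is the imaginary unit and \<open>\<rho>\<close> the real part.\<close>
    define g where "g x = of_real (f x) - of_real (f (smul j x)) * j" for x
    have add: "g (x + y) = g x + g y" for x y
      using f by (simp add: g_def scale_right_distrib linear_add algebra_simps)
    have real: "g (smul (of_real a) x) = of_real a * g x" for a x
    proof -
      have "smul j (smul (of_real a) x) = a *\<^sub>R smul j x"
        by (metis mult.commute scale_scale smul_of_real)
      then show ?thesis
        using f by (simp add: g_def linear_scale smul_of_real algebra_simps)
    qed
    have "smul j (smul j x) = - x" for x
      using complex(1) by (simp add: scale_minus_left)
    then have imag: "g (smul j x) = j * g x" for x
      using f complex(1) by (simp add: g_def linear_neg algebra_simps flip: mult.assoc)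
    have "g (smul c x) = c * g x" for c x
    proof -
      obtain a b where c: "c = of_real a + of_real b * j" using complex(2) by metis
      have "g (smul c x) = g (smul (of_real a) x) + g (smul (of_real b) (smul j x))"
        unfolding c by (simp add: scale_left_distrib add)
      also have "\<dots> = c * g x" by (simp only: real imag c) (simp add: algebra_simps)
      finally show ?thesis .
    qed
    with add have lin: "Vector_Spaces.linear smul (*) g" by (intro linearI)
    have "bounded_linear (smul j)"
      by (rule bounded_linear_intro[where K = "norm j"])
        (auto simp: scale_right_distrib norm_smul mult.commute simp flip: smul_of_real)
    then have "continuous_on UNIV (\<lambda>x. f (smul j x))"
      by (intro continuous_on_compose2[OF cont] linear_continuous_on) auto
    with cont have "continuous_on UNIV g"
      unfolding g_def by (intro continuous_intros)
    moreover have "\<rho> (g x) = f x" for x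
      using complex(3)[of "f x" "- f (smul j x)"] by (simp add: g_def)
    ultimately show thesis using lin complex(4) by (intro that)
  qed
qed

lemma openin_weak_halfspace:
  fixes f :: "'b \<Rightarrow> real"
  assumes "linear f" "continuous_on UNIV f"
  shows "openin (weak_topology smul) {x. f x < c}"
proof -
  obtain g :: "'b \<Rightarrow> 'k" and \<rho> :: "'k \<Rightarrow> real"
    where g: "Vector_Spaces.linear smul (*) g" "continuous_on UNIV g"
      "continuous_on UNIV \<rho>" "\<And>x. \<rho> (g x) = f x"
    using real_part_of_functional[OF assms] by blast
  have "open (\<rho> -` {..<c})"
    using g(3) by (intro open_vimage) auto
  moreover have "{x. f x < c} = g -` (\<rho> -` {..<c})"
    using g(4) by auto
  ultimately show ?thesis
    unfolding weak_topology_def using g(1,2) by (intro topology_generated_by_Basis) blast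
qed

lemma topspace_weak_topology [simp]: "topspace (weak_topology smul) = UNIV"
proof -
  have "linear (\<lambda>_::'b. 0::real)" by (auto intro: linearI)
  then have "openin (weak_topology smul) UNIV"
    using openin_weak_halfspace[of "\<lambda>_. 0" 1] by simp
  then show ?thesis using openin_subset by blast
qed

lemma closed_convex_imp_weakly_closed:
  assumes "closed A" "convex A"
  shows "closedin (weak_topology smul) A"
proof -
  have "\<exists>U. openin (weak_topology smul) U \<and> x \<in> U \<and> U \<subseteq> - A" if "x \<notin> A" for x
  proof -
    obtain f :: "'b \<Rightarrow> real" where f: "linear f" "\<And>z. \<bar>f z\<bar> \<le> norm z"
      "\<And>a. a \<in> A \<Longrightarrow> f x + infdist x A \<le> f a"
      using convex_separation[OF \<open>convex A\<close>] by blast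
    define \<delta> where "\<delta> = (if A = {} then 1 else infdist x A)"
    have "0 < \<delta>"
      using infdist_pos_not_in_closed[OF \<open>closed A\<close> _ that] by (auto simp: \<delta>_def)
    moreover have "f x + \<delta> \<le> f a" if "a \<in> A" for a
      using f(3)[OF that] that by (auto simp: \<delta>_def)
    moreover have "bounded_linear f"
      using f(1,2) by (intro bounded_linear_intro[where K = 1]) (auto simp: linear_add linear_scale)
    then have "openin (weak_topology smul) {z. f z < f x + \<delta>}"
      using f(1) by (intro openin_weak_halfspace linear_continuous_on) auto
    ultimately show ?thesis by (intro exI[of _ "{z. f z < f x + \<delta>}"]) force
  qed
  then have "openin (weak_topology smul) (- A)"
    by (subst openin_subopen) auto
  then show ?thesis by (simp add: closedin_def Compl_eq_Diff_UNIV)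
qed

lemma weakly_compact_imp_convexly_compact:
  "compactin (weak_topology smul) V \<Longrightarrow> convexly_compact V"
  unfolding compactin_fip convexly_compact_def
  using closed_convex_imp_weakly_closed by blast

end

lemma convexly_compact_INT:
  assumes V: "convexly_compact V" and "I \<noteq> {}"
    and C: "\<And>i. i \<in> I \<Longrightarrow> closed (C i) \<and> convex (C i) \<and> V \<inter> C i \<noteq> {}"
    and directed: "\<And>i j. i \<in> I \<Longrightarrow> j \<in> I \<Longrightarrow> \<exists>k\<in>I. C k \<subseteq> C i \<inter> C j"
  shows "V \<inter> (\<Inter>i\<in>I. C i) \<noteq> {}"
proof -
  have "\<exists>k\<in>I. C k \<subseteq> \<Inter>\<F>" if "finite \<F>" "\<F> \<subseteq> C ` I" for \<F>
    using that
  proof (induction \<F>)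
    case empty
    then show ?case using \<open>I \<noteq> {}\<close> by auto
  next
    case (insert A \<F>)
    then obtain i k where "i \<in> I" "A = C i" "k \<in> I" "C k \<subseteq> \<Inter>\<F>" by auto
    with directed[of i k] show ?case by (metis Inter_insert dual_order.trans le_inf_iff)
  qed
  then have fip: "\<forall>\<F>. finite \<F> \<and> \<F> \<subseteq> C ` I \<longrightarrow> V \<inter> \<Inter>\<F> \<noteq> {}"
    using C by fast
  have "\<forall>D\<in>C ` I. closed D \<and> convex D" using C by auto
  then have "V \<inter> \<Inter>(C ` I) \<noteq> {}"
    using V[unfolded convexly_compact_def] fip by presburger
  then show ?thesis .
qed

text \<open>
  A point of the closure of \<open>V\<close> is the only common point of the closed balls around it, and all of
  these balls meet \<open>V\<close>.
\<close>

lemma convexly_compact_closed: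
  fixes V :: "'b::real_normed_vector set"
  assumes V: "convexly_compact V"
  shows "closed V"
proof -
  have "x \<in> V" if x: "x \<in> closure V" for x
  proof -
    have "V \<inter> (\<Inter>e\<in>{0<..}. cball x e) \<noteq> {}"
    proof (rule convexly_compact_INT[OF V])
      fix e :: real assume "e \<in> {0<..}"
      then obtain y where "y \<in> V" "dist y x < e"
        using x by (auto simp: closure_approachable)
      then show "closed (cball x e) \<and> convex (cball x e) \<and> V \<inter> cball x e \<noteq> {}"
        by (auto simp: dist_commute intro!: exI[of _ y])
    next
      fix d e :: real assume "d \<in> {0<..}" "e \<in> {0<..}"
      then show "\<exists>k\<in>{0<..}. cball x k \<subseteq> cball x d \<inter> cball x e"
        by (intro bexI[of _ "min d e"]) auto
    qed auto
    then obtain y where y: "y \<in> V" "\<forall>e\<in>{0<..}. dist x y \<le> e" by auto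
    then have "dist x y \<le> 0 + e" if "0 < e" for e using that by simp
    then have "dist x y \<le> 0" by (rule field_le_epsilon)
    with y(1) show ?thesis by simp
  qed
  then show ?thesis by (metis closure_subset_eq subsetI)
qed

text \<open>
  If \<open>f\<close> were unbounded above on \<open>V\<close>, the half-spaces \<open>{x. n \<le> f x}\<close> would all meet \<open>V\<close>, but they have
  no common point.
\<close>

lemma convexly_compact_bounded_functional:
  fixes V :: "'b::real_normed_vector set" and f :: "'b \<Rightarrow> real"
  assumes V: "convexly_compact V" and f: "bounded_linear f"
  shows "\<exists>c. \<forall>x\<in>V. f x \<le> c"
proof (rule ccontr)
  assume unbounded: "\<nexists>c. \<forall>x\<in>V. f x \<le> c"
  have "V \<inter> (\<Inter>n. {x. f x \<ge> real n}) \<noteq> {}"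
  proof (rule convexly_compact_INT[OF V])
    fix n :: nat
    have "linear f" using f by (simp add: bounded_linear.linear)
    then have "convex {x. real n \<le> f x}"
      using convex_linear_vimage[of f "{real n..}"] by (simp add: vimage_def)
    moreover have "closed {x. real n \<le> f x}"
      using f by (intro closed_Collect_le continuous_intros linear_continuous_on) 
    moreover obtain x where "x \<in> V" "f x > real n" using unbounded by (meson not_le)
    ultimately show "closed {x. real n \<le> f x} \<and> convex {x. real n \<le> f x} \<and>
        V \<inter> {x. real n \<le> f x} \<noteq> {}"
      by force
  next
    fix m n :: nat
    show "\<exists>k\<in>UNIV. {x. real k \<le> f x} \<subseteq> {x. real m \<le> f x} \<inter> {x. real n \<le> f x}"
      by (intro bexI[of _ "max m n"]) auto
  qed auto
  then obtain x where "\<And>n. real n \<le> f x" by auto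
  then show False using reals_Archimedean2[of "f x"] by (meson not_le)
qed

text \<open>
  A uniform boundedness argument: every functional is bounded above on \<open>V\<close>, so the closed sets
  \<open>S n\<close> of functionals that are at most \<open>n\<close> on \<open>V\<close> cover the dual space, and by Baire's theorem one
  of them contains a ball \<open>cball f e\<close>. Adding to \<open>f\<close> the multiple by \<open>e\<close> of a functional that norms
  \<open>z \<in> V\<close> bounds \<open>e \<parallel>z\<parallel>\<close> by \<open>n - f z\<close>, and \<open>- f\<close> is bounded above on \<open>V\<close> as well.
\<close>

lemma convexly_compact_bounded:
  fixes V :: "'b::real_normed_vector set"
  assumes V: "convexly_compact V"
  shows "bounded V"
proof -
  define S :: "nat \<Rightarrow> ('b \<Rightarrow>\<^sub>L real) set" where "S n = {f. \<forall>x\<in>V. blinfun_apply f x \<le> real n}" for n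
  have "closed (S n)" for n
  proof -
    have "S n = (\<Inter>x\<in>V. {f. blinfun_apply f x \<le> real n})" by (auto simp: S_def)
    then show ?thesis by (auto intro!: closed_INT closed_Collect_le continuous_intros)
  qed
  moreover have cover: "(\<Union>n. S n) = UNIV"
  proof -
    have "\<exists>n. f \<in> S n" for f
    proof -
      obtain c where c: "\<forall>x\<in>V. blinfun_apply f x \<le> c"
        using convexly_compact_bounded_functional[OF V blinfun.bounded_linear_right[of f]] by blast
      obtain n where "c \<le> real n" using real_arch_simple by blast
      with c show ?thesis by (intro exI[of _ n]) (force simp: S_def)
    qed
    then show ?thesis by auto
  qed
  ultimately have "\<exists>n. interior (S n) \<noteq> {}"
  proof -
    assume S: "\<And>n. closed (S n)" "(\<Union>n. S n) = UNIV"
    show ?thesis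
    proof (rule ccontr)
      assume "\<nexists>n. interior (S n) \<noteq> {}"
      then have "(euclidean interior_of (\<Union>(range S))) = {}"
        using S(1)
        by (intro Baire_category_alt disjI1 completely_metrizable_space_euclidean) auto
      with S(2) show False by simp
    qed
  qed
  then obtain n f e where f: "0 < e" "cball f e \<subseteq> S n"
    by (metis ex_in_conv mem_interior_cball)
  have "- f \<in> (\<Union>n. S n)" using cover by simp
  then obtain m where m: "- f \<in> S m" by blast
  have "norm z \<le> (real n + real m) / e" if "z \<in> V" for z
  proof -
    obtain g :: "'b \<Rightarrow> real" where g: "linear g" "\<And>x. \<bar>g x\<bar> \<le> norm x" "g (- z) + norm z \<le> 0"
      using convex_separation[of "{0}" "- z"] by (auto simp: linear_0)
    have "bounded_linear g"
      using g(1,2) by (intro bounded_linear_intro[where K = 1]) (auto simp: linear_add linear_scale)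
    then have G: "blinfun_apply (Blinfun g) = g" by (rule bounded_linear_Blinfun_apply)
    have "norm (Blinfun g) \<le> 1"
      by (rule norm_blinfun_bound) (use G g(2) in auto)
    then have "f + e *\<^sub>R Blinfun g \<in> cball f e"
      using \<open>0 < e\<close> by (simp add: dist_norm)
    then have "blinfun_apply f z + e * g z \<le> real n"
      using f(2) that G by (auto simp: S_def blinfun.add_left blinfun.scaleR_left)
    moreover have "- blinfun_apply f z \<le> real m"
      using m that by (auto simp: S_def blinfun.minus_left)
    moreover have "e * norm z \<le> e * g z"
      using g(3) \<open>0 < e\<close> linear_neg[OF g(1), of z] by simp
    ultimately have "e * norm z \<le> real n + real m" by simp
    then show ?thesis using \<open>0 < e\<close> by (simp add: field_simps)
  qed
  then show ?thesis unfolding bounded_iff by blast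
qed

lemma convexly_compact_Int_closed_convex:
  assumes "convexly_compact V" "closed D" "convex D"
  shows "convexly_compact (V \<inter> D)"
  unfolding convexly_compact_def
proof clarify
  fix \<U> assume \<U>: "\<forall>C\<in>\<U>. closed C \<and> convex C"
    and fip: "\<forall>\<F>. finite \<F> \<and> \<F> \<subseteq> \<U> \<longrightarrow> V \<inter> D \<inter> \<Inter>\<F> \<noteq> {}"
    and empty: "V \<inter> D \<inter> \<Inter>\<U> = {}"
  have "V \<inter> \<Inter>\<F> \<noteq> {}" if "finite \<F>" "\<F> \<subseteq> insert D \<U>" for \<F>
  proof -
    have "finite (\<F> - {D})" "\<F> - {D} \<subseteq> \<U>" using that by auto
    then have "V \<inter> D \<inter> \<Inter>(\<F> - {D}) \<noteq> {}" using fip by simp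
    then show ?thesis by blast
  qed
  moreover have "\<forall>C\<in>insert D \<U>. closed C \<and> convex C" using \<U> assms by simp
  ultimately have "V \<inter> \<Inter>(insert D \<U>) \<noteq> {}"
    using assms(1)[unfolded convexly_compact_def] by presburger
  with empty show False by auto
qed

section \<open>Chebyshev radius and Chebyshev center\<close>

lemma bdd_above_norm_diff:
  fixes K :: "'b::real_normed_vector set"
  assumes "bounded K"
  shows "bdd_above ((\<lambda>y. norm (x - y)) ` K)"
proof -
  obtain c where "\<And>y. y \<in> K \<Longrightarrow> dist x y \<le> c" using assms by (auto simp: bounded_any_center[of K x])
  then show ?thesis by (intro bdd_aboveI2[where M = c]) (simp add: dist_norm)
qed

lemma cheb_radius_at_le_iff:
  assumes "bounded K" "K \<noteq> {}"
  shows "cheb_radius_at K x \<le> r \<longleftrightarrow> (\<forall>y\<in>K. dist x y \<le> r)"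
  unfolding cheb_radius_at_def dist_norm
  by (rule cSUP_le_iff[OF assms(2) bdd_above_norm_diff[OF assms(1)]])

lemma cheb_radius_at_le_eq_cballs:
  assumes "bounded K" "K \<noteq> {}"
  shows "{x. cheb_radius_at K x \<le> r} = (\<Inter>y\<in>K. cball y r)"
  by (auto simp: cheb_radius_at_le_iff[OF assms] dist_commute)

lemma closed_convex_cheb_radius_at_le:
  assumes "bounded K" "K \<noteq> {}"
  shows "closed {x. cheb_radius_at K x \<le> r}" "convex {x. cheb_radius_at K x \<le> r}"
  by (auto simp: cheb_radius_at_le_eq_cballs[OF assms] intro: convex_INT)

lemma bdd_below_cheb_radius_at:
  assumes "bounded K" "K \<noteq> {}"
  shows "bdd_below (cheb_radius_at K ` F)"
proof (rule bdd_belowI2[where m = 0])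
  fix x
  obtain y where "y \<in> K" using assms(2) by blast
  moreover have "\<forall>y\<in>K. dist x y \<le> cheb_radius_at K x"
    using cheb_radius_at_le_iff[OF assms] by blast
  ultimately show "0 \<le> cheb_radius_at K x" using zero_le_dist order_trans by blast
qed

lemma mem_cheb_center_iff:
  assumes "bounded K" "K \<noteq> {}"
  shows "x \<in> cheb_center K F \<longleftrightarrow> x \<in> F \<and> cheb_radius_at K x \<le> cheb_radius K F"
proof -
  have "cheb_radius K F \<le> cheb_radius_at K x" if "x \<in> F"
    unfolding cheb_radius_def by (rule cINF_lower[OF bdd_below_cheb_radius_at[OF assms] that])
  then show ?thesis by (auto simp: cheb_center_def)
qed

text \<open>
  The center is the intersection of the closed convex sets of points whose radius is at most
  \<open>r + e\<close> for \<open>e > 0\<close>, where \<open>r\<close> is the Chebyshev radius.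
\<close>

lemma cheb_center_nonempty:
  fixes V :: "'b::real_normed_vector set"
  assumes V: "convexly_compact V" and "V \<noteq> {}"
  shows "cheb_center V V \<noteq> {}"
proof -
  have bounded: "bounded V" by (rule convexly_compact_bounded[OF V])
  let ?r = "cheb_radius V V"
  let ?C = "\<lambda>e. {x. cheb_radius_at V x \<le> ?r + e}"
  have "V \<inter> (\<Inter>e\<in>{0<..}. ?C e) \<noteq> {}"
  proof (rule convexly_compact_INT[OF V])
    fix e :: real assume "e \<in> {0<..}"
    then have "(INF x\<in>V. cheb_radius_at V x) < ?r + e" by (simp add: cheb_radius_def)
    then obtain x where "x \<in> V" "cheb_radius_at V x < ?r + e"
      using cINF_less_iff[OF \<open>V \<noteq> {}\<close> bdd_below_cheb_radius_at[OF bounded \<open>V \<noteq> {}\<close>]] by blast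
    then have "V \<inter> ?C e \<noteq> {}" by force
    then show "closed (?C e) \<and> convex (?C e) \<and> V \<inter> ?C e \<noteq> {}"
      using closed_convex_cheb_radius_at_le[OF bounded \<open>V \<noteq> {}\<close>] by blast
  next
    fix d e :: real assume "d \<in> {0<..}" "e \<in> {0<..}"
    then show "\<exists>k\<in>{0<..}. ?C k \<subseteq> ?C d \<inter> ?C e"
      by (intro bexI[of _ "min d e"]) auto
  qed auto
  then obtain x where x: "x \<in> V" "\<forall>e\<in>{0<..}. cheb_radius_at V x \<le> ?r + e" by auto
  have "cheb_radius_at V x \<le> ?r"
    by (rule field_le_epsilon) (use x(2) in simp)
  with x(1) show ?thesis
    using mem_cheb_center_iff[OF bounded \<open>V \<noteq> {}\<close>] by blast
qed

lemma closed_cheb_center: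
  fixes V :: "'b::real_normed_vector set"
  assumes "convexly_compact V"
  shows "closed (cheb_center V V)"
proof (cases "V = {}")
  case True
  then show ?thesis by (simp add: cheb_center_def)
next
  case False
  have bounded: "bounded V" by (rule convexly_compact_bounded[OF assms])
  have "cheb_center V V = V \<inter> {x. cheb_radius_at V x \<le> cheb_radius V V}"
    using mem_cheb_center_iff[OF bounded False] by blast
  then show ?thesis
    by (simp only:) (intro closed_Int convexly_compact_closed[OF assms]
        closed_convex_cheb_radius_at_le(1)[OF bounded False])
qed

section \<open>Fixed points of nonexpansive maps and isometries\<close>

lemma normal_structure_subset:
  "normal_structure V \<Longrightarrow> D \<subseteq> V \<Longrightarrow> normal_structure D"
  unfolding normal_structure_def by (meson order_trans)

lemma minimal_invariant_set:
  fixes D :: "'b::real_normed_vector set"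
  assumes D: "convexly_compact D" "convex D" "D \<noteq> {}" and T: "T ` D \<subseteq> D"
  obtains E where "E \<subseteq> D" "E \<noteq> {}" "closed E" "convex E" "T ` E \<subseteq> E"
    "\<And>H. H \<subseteq> E \<Longrightarrow> H \<noteq> {} \<Longrightarrow> closed H \<Longrightarrow> convex H \<Longrightarrow> T ` H \<subseteq> H \<Longrightarrow> H = E"
proof -
  define A where "A = {E. E \<subseteq> D \<and> E \<noteq> {} \<and> closed E \<and> convex E \<and> T ` E \<subseteq> E}"
  let ?P = "\<lambda>E H :: 'b set. H \<subseteq> E"
  have "\<exists>m\<in>A. \<forall>a\<in>A. ?P m a \<longrightarrow> a = m"
  proof (rule predicate_Zorn)
    show "partial_order_on A (relation_of ?P A)"
      by (rule partial_order_on_relation_ofI) auto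
    fix C assume C: "C \<in> Chains (relation_of ?P A)"
    then have sub: "C \<subseteq> A" and chain: "\<And>E H. E \<in> C \<Longrightarrow> H \<in> C \<Longrightarrow> E \<subseteq> H \<or> H \<subseteq> E"
      by (auto simp: Chains_def relation_of_def)
    show "\<exists>u\<in>A. \<forall>a\<in>C. ?P a u"
    proof (cases "C = {}")
      case True
      have "D \<in> A" using D T convexly_compact_closed[OF D(1)] by (auto simp: A_def)
      with True show ?thesis by auto
    next
      case False
      have "D \<inter> (\<Inter>E\<in>C. E) \<noteq> {}"
      proof (rule convexly_compact_INT[OF D(1) False])
        fix E assume "E \<in> C"
        then show "closed E \<and> convex E \<and> D \<inter> E \<noteq> {}" using sub by (auto simp: A_def)
      next
        fix E H assume "E \<in> C" "H \<in> C"
        then show "\<exists>K\<in>C. K \<subseteq> E \<inter> H" using chain[of E H] by blast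
      qed
      then have "\<Inter>C \<noteq> {}" by auto
      moreover have "\<forall>E\<in>C. E \<subseteq> D \<and> closed E \<and> convex E \<and> T ` E \<subseteq> E"
        using sub by (auto simp: A_def)
      moreover from this have "\<Inter>C \<subseteq> D" "T ` \<Inter>C \<subseteq> \<Inter>C" using False by blast+
      ultimately have "\<Inter>C \<in> A"
        unfolding A_def by (auto intro!: closed_Inter convex_Inter)
      then show ?thesis by (intro bexI[of _ "\<Inter>C"]) auto
    qed
  qed
  then show thesis using that unfolding A_def by force
qed

text \<open>
  Kirk's theorem. A minimal invariant closed convex set \<open>E\<close> is the closed convex hull of its image.
  If it had two points, normal structure would provide a radius \<open>r\<close> below the diameter that is
  attained at some point of \<open>E\<close>. The points \<open>z \<in> E\<close> with \<open>E \<subseteq> cball z r\<close> are invariant: \<open>T ` E\<close> lies in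
  \<open>cball (T z) r\<close>, hence so does its closed convex hull \<open>E\<close>. By minimality these points exhaust \<open>E\<close>, so
  the diameter is at most \<open>r\<close>.
\<close>

lemma Kirk_fixed_point:
  fixes D :: "'b::real_normed_vector set"
  assumes D: "convexly_compact D" "convex D" "D \<noteq> {}" "normal_structure D"
    and T: "T ` D \<subseteq> D"
    and nonexpansive: "\<And>x y. x \<in> D \<Longrightarrow> y \<in> D \<Longrightarrow> dist (T x) (T y) \<le> dist x y"
  obtains p where "p \<in> D" "T p = p"
proof -
  obtain E where E: "E \<subseteq> D" "E \<noteq> {}" "closed E" "convex E" "T ` E \<subseteq> E"
    and minimal: "\<And>H. H \<subseteq> E \<Longrightarrow> H \<noteq> {} \<Longrightarrow> closed H \<Longrightarrow> convex H \<Longrightarrow> T ` H \<subseteq> H \<Longrightarrow> H = E"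
    using minimal_invariant_set[OF D(1-3) T] by metis
  have bounded: "bounded E"
    using convexly_compact_bounded[OF D(1)] E(1) by (rule bounded_subset)
  have hull: "closure (convex hull (T ` E)) = E"
  proof (rule minimal)
    show sub: "closure (convex hull (T ` E)) \<subseteq> E"
      using E by (intro closure_minimal hull_minimal)
    have "T ` E \<subseteq> closure (convex hull (T ` E))"
      using hull_subset[of "T ` E" convex] closure_subset[of "convex hull (T ` E)"]
      by (rule order_trans)
    with sub show "T ` closure (convex hull (T ` E)) \<subseteq> closure (convex hull (T ` E))" by blast
  qed (use E in auto)
  have "a = b" if "a \<in> E" "b \<in> E" for a b
  proof (rule ccontr)
    assume "a \<noteq> b"
    have "E \<subseteq> D \<Longrightarrow> closed E \<and> convex E \<and> (\<exists>a\<in>E. \<exists>b\<in>E. a \<noteq> b) \<Longrightarrow>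
        \<exists>x\<in>E. cheb_radius_at E x < (SUP (z, y)\<in>E \<times> E. norm (z - y))"
      using D(4) unfolding normal_structure_def by simp
    with E \<open>a \<noteq> b\<close> that
    obtain x where x: "x \<in> E" "cheb_radius_at E x < (SUP (z, y)\<in>E \<times> E. norm (z - y))"
      by auto
    define r where "r = cheb_radius_at E x"
    have le_iff: "cheb_radius_at E z \<le> r \<longleftrightarrow> (\<forall>y\<in>E. dist z y \<le> r)" for z
      by (rule cheb_radius_at_le_iff[OF bounded E(2)])
    let ?H = "E \<inter> {z. cheb_radius_at E z \<le> r}"
    have "?H = E"
    proof (rule minimal)
      show "?H \<noteq> {}" using x(1) by (auto simp: r_def)
      show "closed ?H" "convex ?H"
        using E closed_convex_cheb_radius_at_le[OF bounded E(2)] by (auto intro: convex_Int)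
      show "T ` ?H \<subseteq> ?H"
      proof (intro image_subsetI)
        fix z assume z: "z \<in> ?H"
        have "T ` E \<subseteq> cball (T z) r"
        proof (intro image_subsetI)
          fix y assume "y \<in> E"
          then have "dist (T z) (T y) \<le> dist z y" "dist z y \<le> r"
            using z E(1) le_iff[of z] by (auto intro: nonexpansive)
          then show "T y \<in> cball (T z) r" by simp
        qed
        then have "closure (convex hull (T ` E)) \<subseteq> cball (T z) r"
          by (intro closure_minimal hull_minimal) auto
        then have "\<forall>y\<in>E. dist (T z) y \<le> r" unfolding hull by auto
        then show "T z \<in> ?H" using le_iff[of "T z"] z E(5) by auto
      qed
    qed auto
    then have "\<forall>z\<in>E. \<forall>y\<in>E. dist z y \<le> r" using le_iff by blast
    then have "(SUP (z, y)\<in>E \<times> E. norm (z - y)) \<le> r"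
      using E(2) by (intro cSUP_least) (auto simp: dist_norm)
    with x(2) show False by (simp add: r_def)
  qed
  moreover obtain p where "p \<in> E" using E(2) by blast
  moreover from this have "T p \<in> E" using E(5) by blast
  ultimately show thesis using E(1) that[of p] by blast
qed

text \<open>
  An isometry that is not onto need not map the center into itself, so Kirk's theorem cannot be
  applied to the center. It is applied to the larger set of those \<open>x\<close> for which the radii of the
  decreasing sets \<open>T\<^sup>n V\<close> seen from \<open>x\<close> have a limit of at most \<open>r\<close>. This set is invariant, since
  \<open>T x\<close> sees \<open>T\<^sup>n\<^sup>+\<^sup>1 V\<close> under the radius under which \<open>x\<close> sees \<open>T\<^sup>n V\<close>. A fixed point \<open>p\<close> in it sees
  every \<open>T\<^sup>n V\<close> under the same radius as \<open>V\<close>, because \<open>p = T\<^sup>n p\<close> and \<open>T\<^sup>n\<close> is an isometry; hence \<open>p\<close>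
  belongs to the center.
  
  The set \<open>W\<close> confines the fixed point to a prescribed part of \<open>V\<close>. The radii still refer to all
  of \<open>V\<close>.
\<close>

lemma isometry_fixed_point_in_cheb_center:
  fixes V :: "'b::real_normed_vector set"
  assumes V: "convexly_compact V" "normal_structure V"
    and T: "T ` V \<subseteq> V" and iso: "\<And>x y. x \<in> V \<Longrightarrow> y \<in> V \<Longrightarrow> dist (T x) (T y) = dist x y"
    and W: "W \<subseteq> V" "closed W" "convex W" "T ` W \<subseteq> W" "W \<inter> cheb_center V V \<noteq> {}"
  obtains p where "p \<in> W \<inter> cheb_center V V" "T p = p"
proof -
  have "V \<noteq> {}" using W by blast
  have bounded: "bounded V" by (rule convexly_compact_bounded[OF V(1)])
  define r where "r = cheb_radius V V"
  have pow: "(T ^^ n) y \<in> V" if "y \<in> V" for n y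
    using that T by (induction n) auto
  have iso_pow: "dist ((T ^^ n) x) ((T ^^ n) y) = dist x y" if "x \<in> V" "y \<in> V" for n x y
    using that by (induction n) (simp_all add: iso pow)
  define near where "near n s x \<longleftrightarrow> (\<forall>y\<in>V. dist x ((T ^^ n) y) \<le> s)" for n s x
  have near_mono: "near m t x" if "near n s x" "n \<le> m" "s \<le> t" for n m s t x
    unfolding near_def
  proof
    fix y assume "y \<in> V"
    have "(T ^^ m) y = (T ^^ n) ((T ^^ (m - n)) y)"
      using funpow_add[of n "m - n" T] \<open>n \<le> m\<close> by simp
    moreover have "dist x ((T ^^ n) ((T ^^ (m - n)) y)) \<le> s"
      using that(1) pow[OF \<open>y \<in> V\<close>, of "m - n"] unfolding near_def by blast
    ultimately show "dist x ((T ^^ m) y) \<le> t" using \<open>s \<le> t\<close> by simp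
  qed
  define D where "D = {x \<in> W. \<forall>e>0. \<exists>n. near n (r + e) x}"
  have "D \<noteq> {}"
  proof -
    obtain c where "c \<in> W" "c \<in> cheb_center V V" using W(5) by blast
    then have "near 0 r c"
      using mem_cheb_center_iff[OF bounded \<open>V \<noteq> {}\<close>] cheb_radius_at_le_iff[OF bounded \<open>V \<noteq> {}\<close>]
      by (auto simp: near_def r_def)
    then have "\<exists>n. near n (r + e) c" if "e > 0" for e
      using near_mono[of 0 r c 0 "r + e"] that by auto
    with \<open>c \<in> W\<close> show ?thesis by (auto simp: D_def)
  qed
  have "convex D"
  proof (rule convexI)
    fix x y and u v :: real assume *: "x \<in> D" "y \<in> D" "0 \<le> u" "0 \<le> v" "u + v = 1"
    have "\<exists>n. near n (r + e) (u *\<^sub>R x + v *\<^sub>R y)" if "e > 0" for e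
    proof -
      obtain m n where "near m (r + e) x" "near n (r + e) y"
        using *(1,2) \<open>e > 0\<close> unfolding D_def by blast
      then have "near (max m n) (r + e) x" "near (max m n) (r + e) y"
        using near_mono by (meson max.cobounded1 max.cobounded2 order_refl)+
      then have "u *\<^sub>R x + v *\<^sub>R y \<in> cball ((T ^^ max m n) z) (r + e)" if "z \<in> V" for z
        using * that
        by (intro convexD[OF convex_cball]) (auto simp: near_def dist_commute)
      then have "near (max m n) (r + e) (u *\<^sub>R x + v *\<^sub>R y)" by (auto simp: near_def dist_commute)
      then show ?thesis ..
    qed
    moreover have "u *\<^sub>R x + v *\<^sub>R y \<in> W"
      using * by (intro convexD[OF W(3)]) (auto simp: D_def)
    ultimately show "u *\<^sub>R x + v *\<^sub>R y \<in> D" by (simp add: D_def)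
  qed
  have "closed D"
  proof -
    have "x \<in> D" if x: "x \<in> closure D" for x
    proof -
      have "D \<subseteq> W" by (auto simp: D_def)
      then have "x \<in> W" using closure_minimal[OF _ W(2)] x by blast
      moreover have "\<exists>n. near n (r + e) x" if "e > 0" for e
      proof -
        have "0 < e / 2" using that by simp
        then obtain z where z: "z \<in> D" "dist z x < e / 2"
          using x unfolding closure_approachable by blast
        with \<open>0 < e / 2\<close> obtain n where n: "near n (r + e / 2) z" unfolding D_def by blast
        have "dist x ((T ^^ n) y) \<le> r + e" if "y \<in> V" for y
        proof -
          have "dist z ((T ^^ n) y) \<le> r + e / 2" using n that unfolding near_def by blast
          with z(2) dist_triangle3[of x "(T ^^ n) y" z] show ?thesis by simp
        qed
        then show ?thesis unfolding near_def by blast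
      qed
      ultimately show ?thesis by (simp add: D_def)
    qed
    then show ?thesis by (metis closure_subset_eq subsetI)
  qed
  have "T ` D \<subseteq> D"
  proof (intro image_subsetI)
    fix x assume x: "x \<in> D"
    then have "x \<in> V" "T x \<in> W" using W by (auto simp: D_def)
    have "near (Suc n) s (T x)" if "near n s x" for n s
      using that \<open>x \<in> V\<close> iso pow by (auto simp: near_def)
    with x \<open>T x \<in> W\<close> show "T x \<in> D" unfolding D_def by blast
  qed
  have "D \<subseteq> V" using W(1) by (auto simp: D_def)
  then have "convexly_compact D"
    using convexly_compact_Int_closed_convex[OF V(1) \<open>closed D\<close> \<open>convex D\<close>]
    by (simp add: Int_absorb1)
  moreover have "normal_structure D"
    using V(2) \<open>D \<subseteq> V\<close> by (rule normal_structure_subset)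
  moreover have "dist (T x) (T y) \<le> dist x y" if "x \<in> D" "y \<in> D" for x y
    using iso that \<open>D \<subseteq> V\<close> by (simp add: subset_eq)
  ultimately obtain p where p: "p \<in> D" "T p = p"
    using Kirk_fixed_point[OF _ \<open>convex D\<close> \<open>D \<noteq> {}\<close> _ \<open>T ` D \<subseteq> D\<close>] by blast
  have "p \<in> V" using p \<open>D \<subseteq> V\<close> by blast
  have pow_p: "(T ^^ n) p = p" for n
    by (induction n) (simp_all add: p(2))
  have "dist p y \<le> r" if "y \<in> V" for y
  proof (rule field_le_epsilon)
    fix e :: real assume "0 < e"
    then obtain n where "near n (r + e) p" using p(1) unfolding D_def by blast
    then have "dist p ((T ^^ n) y) \<le> r + e" using that unfolding near_def by blast
    then show "dist p y \<le> r + e"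
      using iso_pow[OF \<open>p \<in> V\<close> that, of n] by (simp add: pow_p)
  qed
  then have "p \<in> cheb_center V V"
    using \<open>p \<in> V\<close> mem_cheb_center_iff[OF bounded \<open>V \<noteq> {}\<close>] cheb_radius_at_le_iff[OF bounded \<open>V \<noteq> {}\<close>]
    by (simp add: r_def)
  with p show thesis by (intro that) (auto simp: D_def)
qed

section \<open>Strong random elements\<close>

lemma strong_random_element_imp_borel_measurable:
  assumes "strong_random_element M S X"
  shows "X \<in> borel_measurable M"
proof -
  obtain Y where Y: "\<And>n. simple_random_element M S (Y n)"
    and lim: "\<And>\<omega>. \<omega> \<in> space M \<Longrightarrow> (\<lambda>n. Y n \<omega>) \<longlonglongrightarrow> X \<omega>"
    using assms unfolding strong_random_element_def by blast
  have "Y n \<in> borel_measurable M" for n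
  proof (rule borel_measurableI)
    fix U :: "'b set" assume "open U"
    then have "Y n -` (S \<inter> U) \<inter> space M \<in> sets M"
      using Y[of n] openin_open_Int[of U S] unfolding simple_random_element_def random_element_def
      by blast
    moreover have "Y n -` (S \<inter> U) \<inter> space M = Y n -` U \<inter> space M"
      using Y[of n] unfolding simple_random_element_def random_element_def by auto
    ultimately show "Y n -` U \<inter> space M \<in> sets M" by simp
  qed
  then show ?thesis using lim by (rule borel_measurable_LIMSEQ_metric)
qed

lemma strong_random_element_countable_range:
  assumes "strong_random_element M S X"
  obtains R where "countable R" "R \<subseteq> S" "\<And>\<omega>. \<omega> \<in> space M \<Longrightarrow> X \<omega> \<in> closure R"
proof -
  obtain Y where Y: "\<And>n. simple_random_element M S (Y n)"
    and lim: "\<And>\<omega>. \<omega> \<in> space M \<Longrightarrow> (\<lambda>n. Y n \<omega>) \<longlonglongrightarrow> X \<omega>"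
    using assms unfolding strong_random_element_def by blast
  let ?R = "\<Union>n. Y n ` space M"
  have "countable ?R"
    using Y by (auto simp: simple_random_element_def intro: countable_finite)
  moreover have "?R \<subseteq> S"
    using Y by (auto simp: simple_random_element_def random_element_def)
  moreover have "X \<omega> \<in> closure ?R" if "\<omega> \<in> space M" for \<omega>
    using lim[OF that] that by (auto simp: closure_sequential intro!: exI[of _ "\<lambda>n. Y n \<omega>"])
  ultimately show thesis by (rule that)
qed

lemma strong_random_element_mono:
  assumes "strong_random_element M S X" "S \<subseteq> S'"
  shows "strong_random_element M S' X"
proof -
  have "simple_random_element M S' Y" if "simple_random_element M S Y" for Y
  proof -
    have Y: "Y \<in> space M \<rightarrow> S" "finite (Y ` space M)"
      and meas: "\<And>U. openin (top_of_set S) U \<Longrightarrow> Y -` U \<inter> space M \<in> sets M"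
      using that by (auto simp: simple_random_element_def random_element_def)
    have "Y -` U \<inter> space M \<in> sets M" if "openin (top_of_set S') U" for U
    proof -
      have "openin (top_of_set S) (S \<inter> U)"
        using that \<open>S \<subseteq> S'\<close> by (auto simp: openin_open)
      moreover have "Y -` (S \<inter> U) \<inter> space M = Y -` U \<inter> space M" using Y(1) by auto
      ultimately show ?thesis using meas by metis
    qed
    with Y \<open>S \<subseteq> S'\<close> show ?thesis by (auto simp: simple_random_element_def random_element_def)
  qed
  with assms show ?thesis unfolding strong_random_element_def by blast
qed

text \<open>
  The approximating simple elements pick a point nearest to \<open>X \<omega>\<close> among \<open>d 0, \<dots>, d n\<close>; \<open>j n \<omega>\<close> is
  its index.
\<close>

lemma strong_random_element_if_separable_range:
  fixes d :: "nat \<Rightarrow> 'a::metric_space"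
  assumes X: "X \<in> borel_measurable M" "X \<in> space M \<rightarrow> S"
    and d: "range d \<subseteq> S" "\<And>\<omega>. \<omega> \<in> space M \<Longrightarrow> X \<omega> \<in> closure (range d)"
  shows "strong_random_element M S X"
proof -
  define j where "j = rec_nat (\<lambda>_. 0)
    (\<lambda>n f \<omega>. if dist (X \<omega>) (d (Suc n)) < dist (X \<omega>) (d (f \<omega>)) then Suc n else f \<omega>)"
  have j_0: "j 0 = (\<lambda>_. 0)"
    and j_Suc: "j (Suc n) = (\<lambda>\<omega>. if dist (X \<omega>) (d (Suc n)) < dist (X \<omega>) (d (j n \<omega>))
      then Suc n else j n \<omega>)" for n
    unfolding j_def by simp_all
  have dist_meas [measurable]: "(\<lambda>\<omega>. dist (X \<omega>) y) \<in> borel_measurable M" for y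
    by (rule measurable_compose[OF X(1)])
      (intro borel_measurable_continuous_onI continuous_intros)
  have j_meas: "j n \<in> measurable M (count_space UNIV)" for n
  proof (induction n)
    case (Suc n)
    note [measurable] = Suc
    have [measurable]: "(\<lambda>\<omega>. dist (X \<omega>) (d (j n \<omega>))) \<in> borel_measurable M"
      by (rule measurable_compose_countable[OF dist_meas Suc])
    show ?case unfolding j_Suc by measurable
  qed (simp add: j_0)
  have j_le: "j n \<omega> \<le> n" for n \<omega>
    by (induction n) (auto simp: j_0 j_Suc intro: le_SucI)
  have nearest: "dist (X \<omega>) (d (j n \<omega>)) \<le> dist (X \<omega>) (d i)" if "i \<le> n" for n i \<omega>
    using that
  proof (induction n)
    case (Suc n)
    then show ?case by (cases "i = Suc n") (force simp: j_Suc)+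
  qed (simp add: j_0)
  have "simple_random_element M S (\<lambda>\<omega>. d (j n \<omega>))" for n
    unfolding simple_random_element_def random_element_def
  proof (intro conjI allI impI)
    show "(\<lambda>\<omega>. d (j n \<omega>)) \<in> space M \<rightarrow> S" using d(1) by auto
    show "(\<lambda>\<omega>. d (j n \<omega>)) -` U \<inter> space M \<in> sets M" for U
      using measurable_sets[OF j_meas[of n], of "d -` U"] by (simp add: vimage_def)
    have "(\<lambda>\<omega>. d (j n \<omega>)) ` space M \<subseteq> d ` {..n}" using j_le by auto
    then show "finite ((\<lambda>\<omega>. d (j n \<omega>)) ` space M)" by (rule finite_subset) simp
  qed
  moreover have "(\<lambda>n. d (j n \<omega>)) \<longlonglongrightarrow> X \<omega>" if \<omega>: "\<omega> \<in> space M" for \<omega>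
    unfolding lim_sequentially
  proof (intro allI impI)
    fix e :: real assume "0 < e"
    then obtain i where "dist (d i) (X \<omega>) < e"
      using d(2)[OF \<omega>] unfolding closure_approachable by blast
    then show "\<exists>N. \<forall>n\<ge>N. dist (d (j n \<omega>)) (X \<omega>) < e"
      using nearest[of i _ \<omega>] by (metis dist_commute order_le_less_trans)
  qed
  ultimately show ?thesis
    unfolding strong_random_element_def
    by (intro conjI X(2) exI[of _ "\<lambda>n \<omega>. d (j n \<omega>)"]) auto
qed

section \<open>Measurable selection\<close>

lemma convergent_if_dist_geometric:
  fixes x :: "nat \<Rightarrow> 'b::banach"
  assumes "\<And>n. dist (x n) (x (Suc n)) \<le> c / 2 ^ n"
  shows "convergent x"
proof -
  have "summable (\<lambda>n. c * (1 / 2) ^ n)"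
    by (intro summable_mult summable_geometric) simp
  then have "summable (\<lambda>n. x (Suc n) - x n)"
    by (rule summable_comparison_test'[where N = 0])
      (use assms in \<open>simp add: dist_norm norm_minus_commute power_one_over\<close>)
  then have "convergent (\<lambda>n. \<Sum>i<n. x (Suc i) - x i)"
    by (simp add: summable_iff_convergent)
  then have "convergent (\<lambda>n. x n - x 0)" by (simp add: sum_lessThan_telescope)
  then have "convergent (\<lambda>n. x n - x 0 + x 0)" by (intro convergent_add convergent_const)
  then show ?thesis by simp
qed

text \<open>
  A selection principle for set-valued maps \<open>F\<close> whose measurability is not known. The sets of all
  \<open>\<omega>\<close> for which \<open>F \<omega>\<close> meets a given ball of radius \<open>1 / 2\<^sup>n\<close> may fail to be measurable, but up to a
  null set their measurable envelopes inherit the covering relations that lead from a ball to balls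
  of half its radius. Following these relations outside a null set, always with the least possible
  index, gives measurable approximations that converge. The envelopes \<open>E n i\<close> may be chosen inside
  the measurable sets \<open>H n i\<close>, which is how the limit retains information about \<open>F\<close>: if membership in
  \<open>H n i\<close> says that \<open>d i\<close> satisfies an equation up to an error of order \<open>1 / 2\<^sup>n\<close>, then the limit
  satisfies it exactly, by continuity.
\<close>

lemma measurable_selection:
  fixes F :: "'w \<Rightarrow> 'b::banach set" and d :: "nat \<Rightarrow> 'b"
  assumes M: "finite_measure M"
    and F: "\<And>\<omega>. \<omega> \<in> space M \<Longrightarrow> F \<omega> \<noteq> {}" "\<And>\<omega>. \<omega> \<in> space M \<Longrightarrow> F \<omega> \<subseteq> closure (range d)"
    and H: "\<And>n i. H n i \<in> sets M"
      "\<And>n i. {\<omega> \<in> space M. F \<omega> \<inter> ball (d i) (1 / 2 ^ n) \<noteq> {}} \<subseteq> H n i"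
  obtains X where "X \<in> borel_measurable M" "range X \<subseteq> closure (range d)"
    "AE \<omega> in M. \<exists>i. (\<lambda>n. d (i n)) \<longlonglongrightarrow> X \<omega> \<and> (\<forall>n. \<omega> \<in> H n (i n))"
proof -
  interpret finite_measure M by (rule M)
  define A where "A n i = {\<omega> \<in> space M. F \<omega> \<inter> ball (d i) (1 / 2 ^ n) \<noteq> {}}" for n i
  have "\<exists>E. measurable_envelope M (A n i) E" for n i
  proof -
    have "A n i \<subseteq> (\<Union>_::nat. space M)" by (auto simp: A_def)
    then have "\<exists>E\<subseteq>(\<Union>_::nat. space M). measurable_envelope M (A n i) E"
      by (intro measurable_envelopeI_countable_cover) (auto simp flip: less_top)
    then show ?thesis by blast
  qed
  then obtain E' where E': "\<And>n i. measurable_envelope M (A n i) (E' n i)" by metis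
  define E where "E n i = E' n i \<inter> H n i" for n i
  have E_sets [measurable]: "E n i \<in> sets M" for n i
    unfolding E_def by (intro sets.Int H(1) measurable_envelopeD(2)[OF E'])
  have A_E: "A n i \<subseteq> E n i" for n i
    using measurable_envelopeD(1)[OF E'] H(2) unfolding E_def A_def by blast
  have E_null: "emeasure M N = 0" if "N \<in> sets M" "N \<subseteq> E n i - A n i" for N n i
    using measurable_envelopeD1[OF E', of N n i] that by (auto simp: E_def)
  have near: "\<exists>i. dist (d i) z < 1 / 2 ^ n" if "z \<in> F \<omega>" "\<omega> \<in> space M" for z \<omega> and n :: nat
  proof -
    have "z \<in> closure (range d)" using F(2) that by blast
    moreover have "(0::real) < 1 / 2 ^ n" by simp
    ultimately show ?thesis unfolding closure_approachable by blast
  qed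
  have start: "\<exists>i. \<omega> \<in> E 0 i" if \<omega>: "\<omega> \<in> space M" for \<omega>
  proof -
    obtain z where z: "z \<in> F \<omega>" using F(1)[OF \<omega>] by blast
    then obtain i where "dist (d i) z < 1 / 2 ^ 0" using near \<omega> by blast
    with z \<omega> have "\<omega> \<in> A 0 i" by (auto simp: A_def)
    with A_E show ?thesis by blast
  qed
  let ?next = "\<lambda>n i j \<omega>. dist (d i) (d j) \<le> 2 / 2 ^ n \<and> \<omega> \<in> E (Suc n) j"
  have A_next: "\<exists>j. ?next n i j \<omega>" if \<omega>_A: "\<omega> \<in> A n i" for n i \<omega>
  proof -
    obtain z where z: "z \<in> F \<omega>" "dist (d i) z < 1 / 2 ^ n" and \<omega>: "\<omega> \<in> space M"
      using \<omega>_A by (auto simp: A_def)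
    obtain j where j: "dist (d j) z < 1 / 2 ^ Suc n" using near z(1) \<omega> by blast
    then have "\<omega> \<in> A (Suc n) j" using z \<omega> by (auto simp: A_def)
    moreover have "(1::real) / 2 ^ Suc n \<le> 1 / 2 ^ n" by (simp add: field_simps)
    then have "dist (d i) (d j) \<le> 2 / 2 ^ n"
      using z(2) j dist_triangle2[of "d i" "d j" z] by simp
    ultimately show ?thesis using A_E by blast
  qed
  \<comment> \<open>The exceptional set is measurable and misses \<open>A n i\<close>, and \<open>E n i\<close> lies in an envelope of \<open>A n i\<close>.\<close>
  have "AE \<omega> in M. \<omega> \<in> E n i \<longrightarrow> (\<exists>j. ?next n i j \<omega>)" for n i
  proof -
    let ?N = "{\<omega> \<in> space M. \<omega> \<in> E n i \<and> (\<forall>j. \<not> ?next n i j \<omega>)}"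
    have "?N \<in> sets M" by measurable
    moreover have "?N \<subseteq> E n i - A n i" using A_next by blast
    ultimately have "?N \<in> null_sets M" using E_null by (intro null_setsI) auto
    then show ?thesis by (rule AE_I') auto
  qed
  then have "AE \<omega> in M. \<forall>n i. \<omega> \<in> E n i \<longrightarrow> (\<exists>j. ?next n i j \<omega>)"
    by (simp add: AE_all_countable)
  then obtain N where N: "N \<in> null_sets M"
    "\<And>\<omega> n i. \<omega> \<in> space M - N \<Longrightarrow> \<omega> \<in> E n i \<Longrightarrow> \<exists>j. ?next n i j \<omega>"
    by (elim AE_E3) blast
  define \<iota> where "\<iota> = rec_nat (\<lambda>\<omega>. LEAST j. \<omega> \<in> E 0 j) (\<lambda>n f \<omega>. LEAST j. ?next n (f \<omega>) j \<omega>)"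
  have \<iota>_0: "\<iota> 0 = (\<lambda>\<omega>. LEAST j. \<omega> \<in> E 0 j)"
    and \<iota>_Suc: "\<iota> (Suc n) = (\<lambda>\<omega>. LEAST j. ?next n (\<iota> n \<omega>) j \<omega>)" for n
    unfolding \<iota>_def by simp_all
  have \<iota>_meas: "\<iota> n \<in> measurable M (count_space UNIV)" for n
  proof (induction n)
    case 0
    show ?case unfolding \<iota>_0 by measurable
  next
    case (Suc n)
    have "(\<lambda>\<omega>. LEAST j. ?next n i j \<omega>) \<in> measurable M (count_space UNIV)" for i
      by measurable
    from measurable_compose_countable[OF this Suc] show ?case unfolding \<iota>_Suc .
  qed
  have \<iota>_E: "\<omega> \<in> E n (\<iota> n \<omega>)" if "\<omega> \<in> space M - N" for n \<omega>
  proof (induction n)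
    case 0
    show ?case using start[of \<omega>] that unfolding \<iota>_0 by (auto intro: LeastI_ex)
  next
    case (Suc n)
    from LeastI_ex[OF N(2)[OF that Suc]] show ?case unfolding \<iota>_Suc by blast
  qed
  have \<iota>_dist: "dist (d (\<iota> n \<omega>)) (d (\<iota> (Suc n) \<omega>)) \<le> 2 / 2 ^ n" if "\<omega> \<in> space M - N" for n \<omega>
    using LeastI_ex[OF N(2)[OF that \<iota>_E[OF that, of n]]] unfolding \<iota>_Suc by blast
  define Z where "Z n \<omega> = (if \<omega> \<in> space M - N then d (\<iota> n \<omega>) else d 0)" for n \<omega>
  define X where "X \<omega> = lim (\<lambda>n. Z n \<omega>)" for \<omega>
  have Z_lim: "(\<lambda>n. Z n \<omega>) \<longlonglongrightarrow> X \<omega>" for \<omega>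
  proof -
    have "convergent (\<lambda>n. Z n \<omega>)"
      using \<iota>_dist[of \<omega>]
      by (cases "\<omega> \<in> space M - N")
        (auto simp: Z_def intro!: convergent_if_dist_geometric[where c = 2] convergent_const)
    then show ?thesis unfolding X_def by (simp add: convergent_LIMSEQ_iff)
  qed
  have "Z n \<in> borel_measurable M" for n
  proof -
    have [measurable]: "N \<in> sets M" using N(1) by blast
    have [measurable]: "(\<lambda>\<omega>. d (\<iota> n \<omega>)) \<in> borel_measurable M"
      by (rule measurable_compose[OF \<iota>_meas]) simp
    show ?thesis unfolding Z_def by measurable
  qed
  then have "X \<in> borel_measurable M"
    using Z_lim by (rule borel_measurable_LIMSEQ_metric)
  moreover have "range X \<subseteq> closure (range d)"
  proof (rule image_subsetI)
    show "X \<omega> \<in> closure (range d)" for \<omega>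
      using Z_lim[of \<omega>] unfolding closure_sequential
    by (intro exI[of _ "\<lambda>n. Z n \<omega>"]) (auto simp: Z_def)
  qed
  moreover have "AE \<omega> in M. \<exists>i. (\<lambda>n. d (i n)) \<longlonglongrightarrow> X \<omega> \<and> (\<forall>n. \<omega> \<in> H n (i n))"
    using AE_not_in[OF N(1)]
  proof (rule AE_mp, intro AE_I2 impI)
    fix \<omega> assume \<omega>: "\<omega> \<in> space M" "\<omega> \<notin> N"
    have "(\<lambda>n. d (\<iota> n \<omega>)) \<longlonglongrightarrow> X \<omega>"
      using Z_lim[of \<omega>] \<omega> by (simp add: Z_def)
    moreover have "\<omega> \<in> H n (\<iota> n \<omega>)" for n
      using \<iota>_E[of \<omega> n] \<omega> by (simp add: E_def)
    ultimately show "\<exists>i. (\<lambda>n. d (i n)) \<longlonglongrightarrow> X \<omega> \<and> (\<forall>n. \<omega> \<in> H n (i n))"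
      by (intro exI[of _ "\<lambda>n. \<iota> n \<omega>"]) simp
  qed
  ultimately show thesis by (rule that)
qed

section \<open>Separable invariant subsets\<close>

lemma closure_rational_unit_interval:
  "closure (\<rat> \<inter> {0..1}) = {0..1::real}"
proof
  show "closure (\<rat> \<inter> {0..1::real}) \<subseteq> {0..1}" by (rule closure_minimal) auto
  show "{0..1::real} \<subseteq> closure (\<rat> \<inter> {0..1})"
  proof
    fix t :: real assume t: "t \<in> {0..1}"
    have "\<exists>q\<in>\<rat> \<inter> {0..1}. dist q t < e" if "0 < e" for e
    proof (cases "t = 1")
      case True
      with that show ?thesis by (intro bexI[of _ 1]) auto
    next
      case False
      with t that obtain q where "q \<in> \<rat>" "t < q" "q < min 1 (t + e)"
        using Rats_dense_in_real[of t "min 1 (t + e)"] by auto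
      with t show ?thesis by (intro bexI[of _ q]) (auto simp: dist_real_def)
    qed
    then show "t \<in> closure (\<rat> \<inter> {0..1})" by (auto simp: closure_approachable)
  qed
qed

lemma convex_closure_if_rationally_convex:
  fixes E :: "'b::real_normed_vector set"
  assumes E: "\<And>x y q. x \<in> E \<Longrightarrow> y \<in> E \<Longrightarrow> q \<in> \<rat> \<inter> {0..1} \<Longrightarrow> q *\<^sub>R x + (1 - q) *\<^sub>R y \<in> E"
  shows "convex (closure E)"
proof -
  let ?f = "\<lambda>(q, x, y). q *\<^sub>R x + (1 - q) *\<^sub>R y :: 'b"
  have "?f ` closure ((\<rat> \<inter> {0..1}) \<times> E \<times> E) \<subseteq> closure E"
  proof (rule image_closure_subset)
    show "continuous_on (closure ((\<rat> \<inter> {0..1}) \<times> E \<times> E)) ?f"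
      unfolding split_beta by (intro continuous_intros)
    show "?f ` ((\<rat> \<inter> {0..1}) \<times> E \<times> E) \<subseteq> closure E"
      using E closure_subset[of E] by auto
  qed simp
  then have *: "?f ` ({0..1} \<times> closure E \<times> closure E) \<subseteq> closure E"
    by (simp add: closure_Times closure_rational_unit_interval)
  show ?thesis
  proof (rule convexI)
    fix x y and u v :: real
    assume "x \<in> closure E" "y \<in> closure E" "0 \<le> u" "0 \<le> v" "u + v = 1"
    then have "(u, x, y) \<in> {0..1} \<times> closure E \<times> closure E" "v = 1 - u" by auto
    then show "u *\<^sub>R x + v *\<^sub>R y \<in> closure E"
      using * by (metis (mono_tags, lifting) case_prod_conv imageI subsetD)
  qed
qed

text \<open>
  Produces a separable closed convex set around \<open>x0\<close> that absorbs, for every \<open>x\<close> of its dense part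
  \<open>E\<close>, a given countable set \<open>R x\<close>. With \<open>R x\<close> dense in the range of \<open>\<omega> \<mapsto> T \<omega> x\<close> it becomes invariant
  under all \<open>T \<omega>\<close> at once.
\<close>

lemma countable_rationally_convex_extension:
  fixes V :: "'b::real_normed_vector set"
  assumes "convex V" "x0 \<in> V" and R: "\<And>x. x \<in> V \<Longrightarrow> countable (R x) \<and> R x \<subseteq> V"
  obtains E where "countable E" "x0 \<in> E" "E \<subseteq> V" "(\<Union>x\<in>E. R x) \<subseteq> E" "convex (closure E)"
proof -
  define step where "step A = A \<union> (\<Union>x\<in>A. R x) \<union>
    (\<lambda>(q, x, y). q *\<^sub>R x + (1 - q) *\<^sub>R y) ` ((\<rat> \<inter> {0..1}) \<times> A \<times> A)" for A
  define S where "S n = (step ^^ n) {x0}" for n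
  have S_Suc: "S (Suc n) = step (S n)" for n by (simp add: S_def)
  have S: "countable (S n) \<and> S n \<subseteq> V" for n
  proof (induction n)
    case 0
    then show ?case using \<open>x0 \<in> V\<close> by (simp add: S_def)
  next
    case (Suc n)
    have "q *\<^sub>R x + (1 - q) *\<^sub>R y \<in> V" if "x \<in> S n" "y \<in> S n" "q \<in> {0..1}" for q x y
      using that Suc by (intro convexD[OF \<open>convex V\<close>]) auto
    moreover have "countable (\<Union>x\<in>S n. R x)"
      using Suc R by (intro countable_UN) auto
    moreover have "countable ((\<rat> \<inter> {0..1::real}) \<times> S n \<times> S n)"
      using Suc countable_rat by (intro countable_SIGMA countable_Int1) auto
    ultimately show ?case
      using Suc R unfolding S_Suc step_def by (auto simp: subset_eq)
  qed
  have "S n \<subseteq> S (Suc n)" for n by (auto simp: S_Suc step_def)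
  then have mono: "S m \<subseteq> S n" if "m \<le> n" for m n
    using that by (rule lift_Suc_mono_le)
  let ?E = "\<Union>n. S n"
  have "(\<Union>x\<in>?E. R x) \<subseteq> ?E"
  proof (rule UN_least)
    fix x assume "x \<in> ?E"
    then obtain n where "x \<in> S n" by blast
    then have "R x \<subseteq> S (Suc n)" by (auto simp: S_Suc step_def)
    then show "R x \<subseteq> ?E" by blast
  qed
  moreover have "convex (closure ?E)"
  proof (rule convex_closure_if_rationally_convex)
    fix x y and q :: real assume "x \<in> ?E" "y \<in> ?E" and q: "q \<in> \<rat> \<inter> {0..1}"
    then obtain m n where "x \<in> S m" "y \<in> S n" by blast
    then have "x \<in> S (max m n)" "y \<in> S (max m n)"
      using mono[of m "max m n"] mono[of n "max m n"] by auto
    then have "q *\<^sub>R x + (1 - q) *\<^sub>R y \<in> S (Suc (max m n))"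
      using q unfolding S_Suc step_def by (intro UnI2) force
    then show "q *\<^sub>R x + (1 - q) *\<^sub>R y \<in> ?E" by blast
  qed
  moreover have "x0 \<in> ?E" by (auto simp: S_def intro!: exI[of _ 0])
  moreover have "countable ?E" "?E \<subseteq> V" using S by auto
  ultimately show thesis by (intro that)
qed

lemma dense_sequence_in_separable_subset:
  fixes K E :: "'a::metric_space set"
  assumes "countable E" "K \<subseteq> closure E" "K \<noteq> {}"
  obtains d :: "nat \<Rightarrow> 'a" where "range d \<subseteq> K" "K \<subseteq> closure (range d)"
proof -
  obtain z0 where "z0 \<in> K" using assms(3) by blast
  define c where "c e n =
    (if \<exists>z\<in>K. dist e z < 1 / real (Suc n) then SOME z. z \<in> K \<and> dist e z < 1 / real (Suc n) else z0)"
    for e n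
  have c: "c e n \<in> K" "z \<in> K \<Longrightarrow> dist e z < 1 / real (Suc n) \<Longrightarrow> dist e (c e n) < 1 / real (Suc n)"
    for e n z
  proof -
    have "\<exists>z\<in>K. dist e z < 1 / real (Suc n) \<Longrightarrow> c e n \<in> K \<and> dist e (c e n) < 1 / real (Suc n)"
      unfolding c_def by (simp only: if_True) (rule someI_ex, blast)
    moreover have "\<not> (\<exists>z\<in>K. dist e z < 1 / real (Suc n)) \<Longrightarrow> c e n = z0"
      unfolding c_def by (simp only: if_False)
    ultimately show "c e n \<in> K"
      "z \<in> K \<Longrightarrow> dist e z < 1 / real (Suc n) \<Longrightarrow> dist e (c e n) < 1 / real (Suc n)"
      using \<open>z0 \<in> K\<close> by metis+
  qed
  let ?D = "case_prod c ` (E \<times> UNIV)"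
  have "E \<noteq> {}" using assms(2,3) by auto
  then have D: "countable ?D" "?D \<noteq> {}" using assms(1) by auto
  have "K \<subseteq> closure ?D"
  proof
    fix z assume "z \<in> K"
    have "\<exists>y\<in>?D. dist y z < \<epsilon>" if "0 < \<epsilon>" for \<epsilon>
    proof -
      obtain n where n: "1 / real (Suc n) < \<epsilon> / 2"
        using nat_approx_posE[of "\<epsilon> / 2"] \<open>0 < \<epsilon>\<close> by auto
      obtain e where e: "e \<in> E" "dist e z < 1 / real (Suc n)"
        using \<open>z \<in> K\<close> assms(2) closure_approachable[of z E]
        by (metis of_nat_0_less_iff subsetD zero_less_Suc zero_less_divide_1_iff)
      have "dist (c e n) z < \<epsilon>"
        using c(2)[OF \<open>z \<in> K\<close> e(2)] e(2) n dist_triangle3[of "c e n" z e] by linarith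
      with e(1) show ?thesis by blast
    qed
    then show "z \<in> closure ?D" unfolding closure_approachable by blast
  qed
  moreover have "?D \<subseteq> K" using c(1) by auto
  ultimately show thesis
    using that[of "from_nat_into ?D"] D by (simp add: range_from_nat_into)
qed

section \<open>Random fixed points\<close>

text \<open>
  Fixed points in a separable set \<open>K\<close> can be chosen measurably. If the ball around \<open>d i\<close> of radius
  \<open>1 / 2\<^sup>n\<close> contains a fixed point of the nonexpansive map \<open>T \<omega>\<close>, then \<open>d i\<close> is moved by at most
  \<open>2 / 2\<^sup>n\<close>, and this second condition is measurable in \<open>\<omega>\<close>.
\<close>

lemma random_fixed_point:
  fixes T :: "'w \<Rightarrow> 'b::banach \<Rightarrow> 'b"
  assumes M: "finite_measure M"
    and K: "closed K" "K \<subseteq> closure E" "countable E" "K \<noteq> {}"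
    and T: "\<And>x. x \<in> K \<Longrightarrow> (\<lambda>\<omega>. T \<omega> x) \<in> borel_measurable M"
      "\<And>\<omega> x y. \<omega> \<in> space M \<Longrightarrow> x \<in> K \<Longrightarrow> y \<in> K \<Longrightarrow> dist (T \<omega> x) (T \<omega> y) \<le> dist x y"
    and fixed: "\<And>\<omega>. \<omega> \<in> space M \<Longrightarrow> \<exists>x\<in>K. T \<omega> x = x"
  obtains X where "strong_random_element M K X" "AE \<omega> in M. T \<omega> (X \<omega>) = X \<omega>"
proof -
  obtain d :: "nat \<Rightarrow> 'b" where d: "range d \<subseteq> K" "K \<subseteq> closure (range d)"
    using dense_sequence_in_separable_subset[OF K(3,2,4)] by blast
  have dK: "d i \<in> K" for i using d(1) by auto
  define F where "F \<omega> = {x \<in> K. T \<omega> x = x}" for \<omega>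
  define H where "H n i = {\<omega> \<in> space M. dist (T \<omega> (d i)) (d i) \<le> 2 / 2 ^ n}" for n i
  have H_sets: "H n i \<in> sets M" for n i
  proof -
    have [measurable]: "(\<lambda>\<omega>. dist (T \<omega> (d i)) (d i)) \<in> borel_measurable M"
      by (rule measurable_compose[OF T(1)[OF dK]])
        (intro borel_measurable_continuous_onI continuous_intros)
    show ?thesis unfolding H_def by measurable
  qed
  have F_H: "{\<omega> \<in> space M. F \<omega> \<inter> ball (d i) (1 / 2 ^ n) \<noteq> {}} \<subseteq> H n i" for n i
  proof
    fix \<omega> assume "\<omega> \<in> {\<omega> \<in> space M. F \<omega> \<inter> ball (d i) (1 / 2 ^ n) \<noteq> {}}"
    then obtain z where "\<omega> \<in> space M" "z \<in> F \<omega>" and z: "z \<in> ball (d i) (1 / 2 ^ n)"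
      by blast
    then have "z \<in> K" "T \<omega> z = z" by (auto simp: F_def)
    with \<open>\<omega> \<in> space M\<close> have "dist (T \<omega> (d i)) z \<le> dist (d i) z" using T(2)[of \<omega> "d i" z] dK by simp
    then have "dist (T \<omega> (d i)) (d i) \<le> 2 / 2 ^ n"
      using z dist_triangle2[of "T \<omega> (d i)" "d i" z] by simp
    with \<open>\<omega> \<in> space M\<close> show "\<omega> \<in> H n i" by (simp add: H_def)
  qed
  have F_nonempty: "F \<omega> \<noteq> {}" if "\<omega> \<in> space M" for \<omega>
    using fixed[OF that] by (auto simp: F_def)
  have F_dense: "F \<omega> \<subseteq> closure (range d)" for \<omega>
    using d(2) by (auto simp: F_def)
  obtain X where X: "X \<in> borel_measurable M" "range X \<subseteq> closure (range d)"
    and ae: "AE \<omega> in M. \<exists>i. (\<lambda>n. d (i n)) \<longlonglongrightarrow> X \<omega> \<and> (\<forall>n. \<omega> \<in> H n (i n))"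
    by (rule measurable_selection[OF M F_nonempty F_dense H_sets F_H])
  have XK: "X \<omega> \<in> K" for \<omega>
    using X(2) closure_minimal[OF d(1) K(1)] by blast
  have "strong_random_element M K X"
    by (rule strong_random_element_if_separable_range[OF X(1) _ d(1)]) (use XK X(2) in auto)
  moreover have "AE \<omega> in M. T \<omega> (X \<omega>) = X \<omega>"
    using ae
  proof (rule AE_mp, intro AE_I2 impI)
    fix \<omega> assume \<omega>: "\<omega> \<in> space M"
      and "\<exists>i. (\<lambda>n. d (i n)) \<longlonglongrightarrow> X \<omega> \<and> (\<forall>n. \<omega> \<in> H n (i n))"
    then obtain i where lim: "(\<lambda>n. d (i n)) \<longlonglongrightarrow> X \<omega>" and H: "\<And>n. \<omega> \<in> H n (i n)" by blast
    have to0: "(\<lambda>n. dist (d (i n)) (X \<omega>)) \<longlonglongrightarrow> 0"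
      using lim by (rule tendsto_dist_iff[THEN iffD1])
    have "(\<lambda>n. 2 * dist (d (i n)) (X \<omega>) + 2 * (1 / 2) ^ n) \<longlonglongrightarrow> 2 * 0 + 2 * (0::real)"
      by (intro tendsto_intros to0 LIMSEQ_power_zero) auto
    moreover have "dist (T \<omega> (X \<omega>)) (X \<omega>) \<le> 2 * dist (d (i n)) (X \<omega>) + 2 * (1 / 2) ^ n" for n
    proof -
      have "dist (T \<omega> (d (i n))) (d (i n)) \<le> 2 * (1 / 2) ^ n"
        using H[of n] by (simp add: H_def power_one_over)
      moreover have "dist (T \<omega> (d (i n))) (T \<omega> (X \<omega>)) \<le> dist (d (i n)) (X \<omega>)"
        by (rule T(2)[OF \<omega> dK XK])
      ultimately show ?thesis
        using dist_triangle3[of "T \<omega> (X \<omega>)" "X \<omega>" "T \<omega> (d (i n))"]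
          dist_triangle[of "T \<omega> (d (i n))" "X \<omega>" "d (i n)"] by linarith
    qed
    ultimately have "dist (T \<omega> (X \<omega>)) (X \<omega>) \<le> 2 * 0 + 2 * 0"
      by (intro LIMSEQ_le_const) auto
    then show "T \<omega> (X \<omega>) = X \<omega>" by simp
  qed
  ultimately show thesis by (rule that)
qed

theorem theorem1p19:
  fixes M :: "'w measure"
    and smul :: "'k::real_or_complex \<Rightarrow> 'b::banach \<Rightarrow> 'b"
    and V :: "'b set"
    and T :: "'w \<Rightarrow> 'b \<Rightarrow> 'b"
  assumes "prob_space M"
    and "banach_space_over smul"
    and "V \<noteq> {}"
    and "compactin (weak_topology smul) V"
    and "convex V"
    and "normal_structure V"
    and "strong_random_isometric_operator M V V T"
  shows "\<exists>x0 :: 'w \<Rightarrow> 'b. strong_random_element M (cheb_center V V) x0 \<and>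
           (AE \<omega> in M. T \<omega> (x0 \<omega>) = x0 \<omega>)"
proof -
  interpret prob_space M by (rule assms(1))
  interpret banach_space_over smul by (rule assms(2))
  have V: "convexly_compact V"
    using assms(4) by (rule weakly_compact_imp_convexly_compact)
  let ?C = "cheb_center V V"
  have "?C \<subseteq> V" by (auto simp: cheb_center_def)
  have strong: "strong_random_element M V (\<lambda>\<omega>. T \<omega> x)" if "x \<in> V" for x
    using assms(7) that by (simp add: strong_random_isometric_operator_def strong_random_operator_def)
  have iso: "dist (T \<omega> x) (T \<omega> y) = dist x y" if "\<omega> \<in> space M" "x \<in> V" "y \<in> V" for \<omega> x y
    using assms(7) that by (simp add: strong_random_isometric_operator_def random_isometric_def)
  have T_V: "T \<omega> x \<in> V" if "\<omega> \<in> space M" "x \<in> V" for \<omega> x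
    using strong[OF that(2)] that(1) by (auto simp: strong_random_element_def)
  have "\<exists>R. countable R \<and> R \<subseteq> V \<and> (\<forall>\<omega>\<in>space M. T \<omega> x \<in> closure R)" if "x \<in> V" for x
    using strong_random_element_countable_range[OF strong[OF that]] by metis
  then obtain R where R: "\<And>x. x \<in> V \<Longrightarrow> countable (R x) \<and> R x \<subseteq> V"
    "\<And>x \<omega>. x \<in> V \<Longrightarrow> \<omega> \<in> space M \<Longrightarrow> T \<omega> x \<in> closure (R x)"
    by metis
  obtain c where c: "c \<in> ?C" using cheb_center_nonempty[OF V assms(3)] by blast
  then have "c \<in> V" using \<open>?C \<subseteq> V\<close> by blast
  obtain E where E: "countable E" "c \<in> E" "E \<subseteq> V" "(\<Union>x\<in>E. R x) \<subseteq> E" "convex (closure E)"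
    by (rule countable_rationally_convex_extension[where R = R, OF assms(5) \<open>c \<in> V\<close> R(1)])
  let ?W = "closure E"
  have "?W \<subseteq> V" using E(3) convexly_compact_closed[OF V] by (rule closure_minimal)
  have T_W: "T \<omega> ` ?W \<subseteq> ?W" if "\<omega> \<in> space M" for \<omega>
  proof (rule image_closure_subset)
    have "dist (T \<omega> x) (T \<omega> y) \<le> dist x y" if "x \<in> ?W" "y \<in> ?W" for x y
    proof -
      have "x \<in> V" "y \<in> V" using that \<open>?W \<subseteq> V\<close> by blast+
      then show ?thesis using iso[OF \<open>\<omega> \<in> space M\<close>] by simp
    qed
    then show "continuous_on ?W (T \<omega>)"
      by (intro lipschitz_on_continuous_on[of 1] lipschitz_onI) auto
    show "T \<omega> ` E \<subseteq> ?W"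
    proof (intro image_subsetI)
      fix x assume "x \<in> E"
      then have "T \<omega> x \<in> closure (R x)" "R x \<subseteq> E" using R(2) that E(3,4) by auto
      then show "T \<omega> x \<in> ?W" using closure_mono by blast
    qed
  qed simp
  let ?K = "?W \<inter> ?C"
  have nonempty: "?K \<noteq> {}" using c E(2) closure_subset by blast
  have fixed: "\<exists>x\<in>?K. T \<omega> x = x" if \<omega>: "\<omega> \<in> space M" for \<omega>
  proof -
    have "T \<omega> ` V \<subseteq> V" using T_V[OF \<omega>] by blast
    then obtain p where "p \<in> ?K" "T \<omega> p = p"
      by (rule isometry_fixed_point_in_cheb_center[where T = "T \<omega>", OF V assms(6) _ iso[OF \<omega>]
            \<open>?W \<subseteq> V\<close> closed_closure E(5) T_W[OF \<omega>] nonempty])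
    then show ?thesis by blast
  qed
  have closed: "closed ?K" by (intro closed_Int closed_closure closed_cheb_center V)
  have meas: "(\<lambda>\<omega>. T \<omega> x) \<in> borel_measurable M" if "x \<in> ?K" for x
    using that \<open>?C \<subseteq> V\<close> by (intro strong_random_element_imp_borel_measurable[OF strong]) blast
  have nonexpansive: "dist (T \<omega> x) (T \<omega> y) \<le> dist x y"
    if "\<omega> \<in> space M" "x \<in> ?K" "y \<in> ?K" for \<omega> x y
  proof -
    have "x \<in> V" "y \<in> V" using that(2,3) \<open>?C \<subseteq> V\<close> by blast+
    then show ?thesis using iso[OF that(1)] by simp
  qed
  obtain X where X: "strong_random_element M ?K X" "AE \<omega> in M. T \<omega> (X \<omega>) = X \<omega>"
    by (rule random_fixed_point[where T = T, OF finite_measure_axioms closed Int_lower1 E(1) nonempty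
          meas nonexpansive fixed])
  have "strong_random_element M ?C X"
    using X(1) by (rule strong_random_element_mono) auto
  with X(2) show ?thesis by blast
qed

end
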